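(* Let $0<\alpha\le 1$ and let $\{\mathcal{N}^{\alpha}_{c}(t)\}_{t\ge 0}$ be the convoluted fractional Poisson process with intensity parameters $\{\lambda_j\}_{j\in\mathbb{Z}}$. Then its one-dimensional distribution $p^{\alpha}_{c}(n,t)=\Pr\{\mathcal{N}^{\alpha}_{c}(t)=n\}$, $t\ge 0$, is given by $$p^{\alpha}_{c}(n,t)=\begin{cases}E_{\alpha,1}(-\lambda_{0}t^{\alpha}), & n=0,\\[2mm] \displaystyle\sum_{k=1}^{n}\sum_{\Theta_{n}^{k}}k!\prod_{j=1}^{n}\frac{(\lambda_{j-1}-\lambda_{j})^{k_{j}}}{k_{j}!}\,t^{k\alpha}E_{\alpha,k\alpha+1}^{k+1}(-\lambda_{0}t^{\alpha}), & n\ge 1,\end{cases}$$ where the inner sum runs over $\Theta_{n}^{k}=\{(k_{1},\dots,k_{n}):\sum_{j=1}^{n}k_{j}=k,\ \sum_{j=1}^{n}jk_{j}=n,\ k_{j}\in\mathbb{N}_0\}$.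
   Context: $\mathbb{N}_0$ denotes the non-negative integers; $0^0=1$. Mittag-Leffler functions: for $\alpha,\beta,\gamma>0$, $E_{\alpha,\beta}^{\gamma}(x)=\frac{1}{\Gamma(\gamma)}\sum_{k=0}^{\infty}\frac{\Gamma(\gamma+k)x^k}{k!\,\Gamma(k\alpha+\beta)}$, and $E_{\alpha,1}(x)=E_{\alpha,1}^{1}(x)=\sum_{k=0}^\infty \frac{x^k}{\Gamma(k\alpha+1)}$. Intensity parameters: $\{\lambda_j\}_{j\in\mathbb{Z}}$ are real numbers with $\lambda_j=0$ for $j<0$, $\lambda_0>0$, $\lambda_j\ge 0$ for $j>0$, non-increasing for $j\ge 0$, and $\lim_{j\to\infty}\lambda_{j+1}/\lambda_j<1$ (this limit condition is regarded as satisfied if $\lambda_j=0$ for all large $j$). Fractional derivative (Dzhrbashyan–Caputo): $\partial_t^{\alpha}f(t)=\frac{1}{\Gamma(1-\alpha)}\int_0^t (t-s)^{-\alpha}f'(s)\,\mathrm{d}s$ for $0<\alpha<1$, and $\partial_t^{1}f(t)=f'(t)$. Convoluted fractional Poisson process (CFPP): an $\mathbb{N}_0$-valued stochastic process $\{\mathcal{N}^{\alpha}_{c}(t)\}_{t\ge0}$ whose state probabilities $p^{\alpha}_{c}(n,t)=\Pr\{\mathcal{N}^{\alpha}_{c}(t)=n\}$ satisfy, for all $n\ge 0$, $$\partial_t^{\alpha}p^{\alpha}_{c}(n,t)=-\lambda_n * p^{\alpha}_{c}(n,t)+\lambda_{n-1}*p^{\alpha}_{c}(n-1,t),$$ where $\lambda_n*p^{\alpha}_{c}(n,t)=\sum_{j=-\infty}^{\infty}\lambda_j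 p^{\alpha}_{c}(n-j,t)$ is the discrete convolution in the space variable, with $p^{\alpha}_{c}(0,0)=1$, $p^{\alpha}_{c}(n,0)=0$ for $n\ge 1$, and $p^{\alpha}_{c}(-n,t)=0$ for $n\ge 1$, $t\ge 0$. Equivalently, $\partial_t^{\alpha}p^{\alpha}_{c}(n,t)=-\lambda_0 p^{\alpha}_{c}(n,t)+\sum_{j=1}^{n}(\lambda_{j-1}-\lambda_j)p^{\alpha}_{c}(n-j,t)$. *)

theory Defs
  imports "HOL-Probability.Probability"
begin

definition mittag_leffler3 :: "real \<Rightarrow> real \<Rightarrow> real \<Rightarrow> real \<Rightarrow> real" where
  "mittag_leffler3 \<alpha> \<beta> \<gamma> x =
     1 / Gamma \<gamma> * (\<Sum>k. Gamma (\<gamma> + real k) * x ^ k / (fact k * Gamma (real k * \<alpha> + \<beta>)))"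

definition mittag_leffler :: "real \<Rightarrow> real \<Rightarrow> real \<Rightarrow> real" where
  "mittag_leffler \<alpha> \<beta> x = mittag_leffler3 \<alpha> \<beta> 1 x"

lemma mittag_leffler_series:
  "mittag_leffler \<alpha> \<beta> x = (\<Sum>k. x ^ k / Gamma (real k * \<alpha> + \<beta>))"
  by (simp add: mittag_leffler_def mittag_leffler3_def Gamma_fact)

definition intensity_parameters :: "(int \<Rightarrow> real) \<Rightarrow> bool" where
  "intensity_parameters lam \<longleftrightarrow>
     (\<forall>j<0. lam j = 0) \<and> lam 0 > 0 \<and> (\<forall>j>0. lam j \<ge> 0) \<and>
     (\<forall>i\<ge>0. \<forall>j\<ge>i. lam j \<le> lam i) \<and>
     ((\<exists>J. \<forall>j\<ge>J. lam j = 0) \<or>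
      (\<exists>L<1. ((\<lambda>j. lam (j + 1) / lam j) \<longlongrightarrow> L) at_top))"

definition caputo_deriv :: "real \<Rightarrow> (real \<Rightarrow> real) \<Rightarrow> real \<Rightarrow> real" where
  "caputo_deriv \<alpha> f t =
     (if \<alpha> = 1 then deriv f t
      else 1 / Gamma (1 - \<alpha>) * (LBINT s:{0<..<t}. (t - s) powr (-\<alpha>) * deriv f s))"

(* deriv and the Lebesgue integral are total in HOL, so the existence of the Dzhrbashyan-Caputo
   derivative at all t > 0 is stated separately. Differentiability at 0 is not required: for
   \<alpha> < 1, Mittag-Leffler functions of t powr \<alpha> are only continuous there. Continuity at 0
   is what links the initial value f 0 to the values of f at t > 0. *)
definition caputo_differentiable :: "real \<Rightarrow> (real \<Rightarrow> real) \<Rightarrow> bool" where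
  "caputo_differentiable \<alpha> f \<longleftrightarrow>
     continuous_on {0..} f \<and> (\<forall>t>0. f differentiable (at t)) \<and>
     (\<alpha> \<noteq> 1 \<longrightarrow>
       (\<forall>t>0. set_integrable lborel {0<..<t} (\<lambda>s. (t - s) powr (-\<alpha>) * deriv f s)))"

definition discrete_convolution :: "(int \<Rightarrow> real) \<Rightarrow> (int \<Rightarrow> real) \<Rightarrow> int \<Rightarrow> real" where
  "discrete_convolution a b n = (\<Sum>\<^sub>\<infinity>j. a j * b (n - j))"

(* The differential equations are imposed for t > 0: at t = 0 the integral defining the
   derivative of order \<alpha> < 1 is over the empty interval. *)
definition cfpp_equations ::
    "real \<Rightarrow> (int \<Rightarrow> real) \<Rightarrow> (int \<Rightarrow> real \<Rightarrow> real) \<Rightarrow> bool" where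
  "cfpp_equations \<alpha> lam p \<longleftrightarrow>
     (\<forall>n\<ge>0. caputo_differentiable \<alpha> (p n) \<and>
        (\<forall>t>0. caputo_deriv \<alpha> (p n) t =
           - discrete_convolution lam (\<lambda>m. p m t) n
           + discrete_convolution lam (\<lambda>m. p m t) (n - 1))) \<and>
     p 0 0 = 1 \<and> (\<forall>n\<ge>1. p n 0 = 0) \<and> (\<forall>n\<ge>1. \<forall>t\<ge>0. p (- n) t = 0)"

(* The state n is an integer, so that the convolution can range over all integers. *)
definition state_prob :: "'a measure \<Rightarrow> (real \<Rightarrow> 'a \<Rightarrow> nat) \<Rightarrow> int \<Rightarrow> real \<Rightarrow> real" where
  "state_prob M N n t = measure M {\<omega> \<in> space M. int (N t \<omega>) = n}"

definition conv_frac_poisson_process ::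
    "'a measure \<Rightarrow> real \<Rightarrow> (int \<Rightarrow> real) \<Rightarrow> (real \<Rightarrow> 'a \<Rightarrow> nat) \<Rightarrow> bool" where
  "conv_frac_poisson_process M \<alpha> lam N \<longleftrightarrow>
     prob_space M \<and> (\<forall>t\<ge>0. N t \<in> measurable M (count_space UNIV)) \<and>
     cfpp_equations \<alpha> lam (state_prob M N)"

(* Tuples (k_1, ..., k_n) are functions on {1..n} made unique by being undefined elsewhere. *)
definition Theta :: "nat \<Rightarrow> nat \<Rightarrow> (nat \<Rightarrow> nat) set" where
  "Theta n k =
     {\<kappa> \<in> {1..n} \<rightarrow>\<^sub>E UNIV. (\<Sum>j=1..n. \<kappa> j) = k \<and> (\<Sum>j=1..n. j * \<kappa> j) = n}"

end

theory Submission imports Defs begin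

text \<open>By Fubini and the Beta integral, applying the Riemann-Liouville integral \<open>I\<close> of order \<open>\<alpha>\<close> to the
  differential equations gives \<open>p n = [n = 0] + I (- \<lambda>\<^sub>0 p n + \<Sum>j. a j p (n - j))\<close> with
  \<open>a j = \<lambda> (j - 1) - \<lambda> j\<close>. Such a Volterra system has only one locally bounded solution, because the
  iterates of \<open>I\<close> decay like \<open>t\<^sup>m\<^sup>\<alpha> / \<Gamma> (m \<alpha> + 1)\<close>. Since \<open>I\<close> maps \<open>t\<^sup>m\<^sup>\<alpha> / \<Gamma> (m \<alpha> + 1)\<close> to the next function
  of this kind, a series in these functions solves the system iff its coefficients satisfy a linear
  recursion; for the claimed formula that recursion combines Pascal's rule (for the three-parameter
  Mittag-Leffler coefficients) with removing one part from a tuple in \<open>\<Theta>\<close>.\<close>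

section \<open>Fractional power series\<close>

text \<open>The substitution \<open>s = u + (t - u) * x\<close> reduces this to the Beta integral on
  the unit interval. The case \<open>u = 0\<close> integrates fractional powers against the kernel;
  general \<open>u\<close> with \<open>a + b = 1\<close> serves the inner integral after a change of
  order.\<close>

lemma has_bochner_integral_Beta_interval:
  fixes a b u t :: real
  assumes "a > 0" "b > 0" "u < t"
  shows "has_bochner_integral lborel
    (\<lambda>s. indicator {u<..<t} s * ((s - u) powr (b - 1) * (t - s) powr (a - 1)))
    (Beta b a * (t - u) powr (a + b - 1))"
proof -
  let ?f = "\<lambda>x. x powr (b - 1) * (1 - x) powr (a - 1)"
  have int: "set_integrable lborel {0..1} ?f"
    by (rule integrable_Beta) (use assms in auto)
  have "(LINT x:{0..1}|lborel. ?f x) = Beta b a"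
    using set_borel_integral_eq_integral(2)[OF int] has_integral_Beta_real[of b a] assms
    by (simp add: integral_unique)
  with int have "has_bochner_integral lborel (\<lambda>x. indicator {0..1} x *\<^sub>R ?f x) (Beta b a)"
    unfolding has_bochner_integral_iff set_integrable_def set_lebesgue_integral_def by simp
  \<comment> \<open>The two factors of the integrand scale by this power of \<open>t - u\<close>;
    the missing power 1 is the Jacobian of the substitution.\<close>
  from has_bochner_integral_mult_right[OF this, of "(t - u) powr (a + b - 2)"]
  have 1: "has_bochner_integral lborel
      (\<lambda>x. (t - u) powr (a + b - 2) * (indicator {0..1} x *\<^sub>R ?f x)) ((t - u) powr (a + b - 2) * Beta b a)"
    by simp
  have "(t - u) powr (a + b - 2) * (indicator {0..1} x *\<^sub>R ?f x)
      = indicator {u<..<t} (u + (t - u) * x) *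
        ((u + (t - u) * x - u) powr (b - 1) * (t - (u + (t - u) * x)) powr (a - 1))" for x
  proof (cases "0 < x \<and> x < 1")
    case True
    have e: "t - (u + (t - u) * x) = (t - u) * (1 - x)"
      by (simp add: algebra_simps)
    have "u + (t - u) * x > u" "u + (t - u) * x < t"
      using True assms mult_pos_pos[of "t - u" x] mult_pos_pos[of "t - u" "1 - x"]
      by (simp_all add: algebra_simps)
    then show ?thesis
      using True assms unfolding e
      by (simp add: powr_mult flip: powr_add) (simp add: add.commute)
  next
    case False
    have "\<not> (u < u + (t - u) * x \<and> u + (t - u) * x < t)"
    proof
      assume "u < u + (t - u) * x \<and> u + (t - u) * x < t"
      then have "0 < (t - u) * x" "0 < (t - u) * (1 - x)"
        by (simp_all add: algebra_simps)
      with assms False show False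
        by (simp add: zero_less_mult_iff)
    qed
    \<comment> \<open>The endpoints lie in the closed indicator only, but there the left side
      vanishes too, because \<open>0 powr y\<close> is 0 for every \<open>y\<close>.\<close>
    moreover have "x < 0 \<or> x > 1 \<or> x = 0 \<or> x = 1"
      using False by linarith
    ultimately show ?thesis
      by (auto simp: indicator_def)
  qed
  with 1 have 2: "has_bochner_integral lborel
      (\<lambda>x. indicator {u<..<t} (u + (t - u) * x) *
        ((u + (t - u) * x - u) powr (b - 1) * (t - (u + (t - u) * x)) powr (a - 1)))
      ((t - u) powr (a + b - 2) * Beta b a)"
    by simp
  have e1: "(t - u) powr (a + b - 1) = (t - u) powr (a + b - 2) * (t - u) powr 1"
    unfolding powr_add[symmetric] by simp
  have e2: "Beta b a * (t - u) powr (a + b - 1) /\<^sub>R \<bar>t - u\<bar> = (t - u) powr (a + b - 2) * Beta b a"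
    unfolding e1 using assms by simp
  have "t - u \<noteq> 0"
    using assms by simp
  from lborel_has_bochner_integral_real_affine_iff[OF this, where t = u] show ?thesis
    using 2 unfolding e2[symmetric] by (rule iffD2)
qed

text \<open>Cut the Euler integral down to the half-line from \<open>R\<close>, where the power is
  at least \<open>R powr z\<close>. As \<open>R\<close> is free, this yields growth in
  \<open>z\<close> beyond any geometric rate.\<close>

lemma Gamma_plus1_lower_bound:
  fixes R z :: real
  assumes "R > 0" "z \<ge> 0"
  shows "R powr z * exp (- R) \<le> Gamma (z + 1)"
proof -
  have 1: "((\<lambda>x. R powr z * exp (- x)) has_integral R powr z * exp (- R)) {R..}"
    using has_integral_mult_right[OF has_integral_exp_minus_to_infinity[of 1 R], of "R powr z"] by simp
  have 2: "((\<lambda>x. if x \<in> {R..} then R powr z * exp (- x) else 0) has_integral R powr z * exp (- R)) {0..}"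
    by (rule has_integral_on_superset[OF 1[THEN has_integral_eq[rotated]]]) (use assms in auto)
  show ?thesis
  proof (rule has_integral_le[OF 2 Gamma_integral_real])
    show "z + 1 > 0" using assms by simp
    fix x :: real assume "x \<in> {0..}"
    then show "(if x \<in> {R..} then R powr z * exp (- x) else 0) \<le> x powr (z + 1 - 1) / exp x"
      using assms by (auto simp: exp_minus field_simps intro!: powr_mono2)
  qed
qed

text \<open>At \<open>t = 0\<close> these are junk for \<open>m = 0\<close>, since \<open>0 powr 0 = 0\<close>; hence the assumption
  \<open>t > 0\<close> throughout.\<close>
definition frac_power :: "real \<Rightarrow> nat \<Rightarrow> real \<Rightarrow> real" where
  "frac_power \<alpha> m t = t powr (real m * \<alpha>) / Gamma (real m * \<alpha> + 1)"

definition frac_series :: "real \<Rightarrow> (nat \<Rightarrow> real) \<Rightarrow> real \<Rightarrow> real" where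
  "frac_series \<alpha> d t = (\<Sum>m. d m * frac_power \<alpha> m t)"

text \<open>This growth condition gives absolute convergence of \<open>frac_series\<close> at every
  positive time and survives the finite linear combinations formed from the coefficients.\<close>

definition geo_bounded :: "(nat \<Rightarrow> real) \<Rightarrow> bool" where
  "geo_bounded d \<longleftrightarrow> (\<exists>C R. 0 \<le> R \<and> (\<forall>m. \<bar>d m\<bar> \<le> C * R ^ m))"

lemma frac_power_nonneg: "\<alpha> > 0 \<Longrightarrow> frac_power \<alpha> m t \<ge> 0"
  unfolding frac_power_def
  by (intro divide_nonneg_pos Gamma_real_pos add_nonneg_pos) auto

lemma frac_power_0: "t > 0 \<Longrightarrow> frac_power \<alpha> 0 t = 1"
  by (simp add: frac_power_def)

lemma frac_power_mono: "\<alpha> > 0 \<Longrightarrow> 0 \<le> s \<Longrightarrow> s \<le> t \<Longrightarrow> frac_power \<alpha> m s \<le> frac_power \<alpha> m t"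
  unfolding frac_power_def
  by (intro divide_right_mono powr_mono2 less_imp_le[OF Gamma_real_pos] add_nonneg_pos) auto

lemma frac_power_measurable [measurable]: "frac_power \<alpha> m \<in> borel_measurable borel"
  unfolding frac_power_def by measurable

lemma frac_series_measurable [measurable]: "frac_series \<alpha> d \<in> borel_measurable borel"
  unfolding frac_series_def by measurable

text \<open>Used twice: as the majorant for series with geometrically bounded coefficients, and for
  its terms tending to 0 in the uniqueness argument.\<close>

lemma summable_power_frac_power:
  assumes "\<alpha> > 0" "t > 0" "R \<ge> 0"
  shows "summable (\<lambda>m. R ^ m * frac_power \<alpha> m t)"
proof -
  \<comment> \<open>The Gamma function beats the geometric growth with ratio \<open>Q powr \<alpha>\<close>, for this \<open>Q\<close> twice the required one.\<close>
  define Q where "Q = (2 * (R + 1) * t powr \<alpha>) powr (1 / \<alpha>)"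
  have Q: "Q > 0" "Q powr \<alpha> = 2 * (R + 1) * t powr \<alpha>"
    using assms by (simp_all add: Q_def powr_powr)
  have "summable (\<lambda>m. exp Q * (1 / 2 :: real) ^ m)"
    by (intro summable_mult summable_geometric) simp
  moreover have "norm (R ^ m * frac_power \<alpha> m t) \<le> exp Q * (1 / 2) ^ m" for m
  proof -
    have pos: "0 < Gamma (real m * \<alpha> + 1)" using assms by (intro Gamma_real_pos add_nonneg_pos) auto
    have pw: "x powr (real m * \<alpha>) = (x powr \<alpha>) ^ m" if "x > 0" for x :: real
      using that by (simp add: powr_powr mult.commute flip: powr_realpow)
    have "(2 * (R + 1) * t powr \<alpha>) ^ m * exp (- Q) \<le> Gamma (real m * \<alpha> + 1)"
      using Gamma_plus1_lower_bound[of Q "real m * \<alpha>"] Q assms by (simp add: pw)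
    then have G: "(2 * (R + 1) * t powr \<alpha>) ^ m \<le> Gamma (real m * \<alpha> + 1) * exp Q"
      by (simp add: exp_minus field_simps)
    \<comment> \<open>Passing from \<open>R\<close> to \<open>R + 1\<close> keeps the base, and
      hence \<open>Q\<close>, positive when \<open>R\<close> is 0.\<close>
    have "R ^ m * (t powr \<alpha>) ^ m \<le> ((R + 1) * t powr \<alpha>) ^ m"
      using assms by (simp add: power_mult_distrib mult_right_mono power_mono)
    also have "\<dots> = (2 * (R + 1) * t powr \<alpha>) ^ m * (1 / 2) ^ m"
      unfolding power_mult_distrib[symmetric] by (rule arg_cong[where f = "\<lambda>y. y ^ m"]) simp
    also have "\<dots> \<le> Gamma (real m * \<alpha> + 1) * exp Q * (1 / 2) ^ m"
      using G by (intro mult_right_mono) auto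
    finally have "R ^ m * t powr (real m * \<alpha>) \<le> exp Q * (1 / 2) ^ m * Gamma (real m * \<alpha> + 1)"
      unfolding pw[OF assms(2)] by (simp only: mult_ac)
    then have "R ^ m * frac_power \<alpha> m t \<le> exp Q * (1 / 2) ^ m"
      using pos unfolding frac_power_def times_divide_eq_right by (subst pos_divide_le_eq)
    then show ?thesis
      using frac_power_nonneg[of \<alpha> m t] assms by simp
  qed
  ultimately show ?thesis
    by (rule summable_comparison_test'[where N = 0])
qed

lemma geo_bounded_summable_abs:
  assumes "\<alpha> > 0" "t > 0" "geo_bounded d"
  shows "summable (\<lambda>m. \<bar>d m\<bar> * frac_power \<alpha> m t)"
proof -
  obtain C R where *: "0 \<le> R" "\<And>m. \<bar>d m\<bar> \<le> C * R ^ m"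
    using assms(3) unfolding geo_bounded_def by blast
  have "summable (\<lambda>m. C * (R ^ m * frac_power \<alpha> m t))"
    by (intro summable_mult summable_power_frac_power assms *)
  moreover have "norm (\<bar>d m\<bar> * frac_power \<alpha> m t) \<le> C * (R ^ m * frac_power \<alpha> m t)" for m
    using mult_right_mono[OF *(2)[of m] frac_power_nonneg[OF assms(1), of m t]] frac_power_nonneg[OF assms(1), of m t]
    by (simp add: abs_mult mult.assoc)
  ultimately show ?thesis
    by (rule summable_comparison_test'[where N = 0])
qed

lemma geo_bounded_summable:
  assumes "\<alpha> > 0" "t > 0" "geo_bounded d"
  shows "summable (\<lambda>m. d m * frac_power \<alpha> m t)"
proof (rule summable_rabs_cancel)
  show "summable (\<lambda>m. \<bar>d m * frac_power \<alpha> m t\<bar>)"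
    using geo_bounded_summable_abs[OF assms] frac_power_nonneg[OF assms(1)] by (simp add: abs_mult)
qed

section \<open>Closure properties of geometrically bounded sequences\<close>

lemma geo_bounded_add:
  assumes "geo_bounded c" "geo_bounded d"
  shows "geo_bounded (\<lambda>m. c m + d m)"
proof -
  obtain C R where 1: "0 \<le> R" "\<And>m. \<bar>c m\<bar> \<le> C * R ^ m"
    using assms(1) unfolding geo_bounded_def by blast
  obtain D S where 2: "0 \<le> S" "\<And>m. \<bar>d m\<bar> \<le> D * S ^ m"
    using assms(2) unfolding geo_bounded_def by blast
  have "\<bar>c m + d m\<bar> \<le> (\<bar>C\<bar> + \<bar>D\<bar>) * (R + S) ^ m" for m
  proof -
    have "\<bar>c m\<bar> \<le> \<bar>C\<bar> * (R + S) ^ m"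
      by (rule order.trans[OF 1(2)]) (use 1(1) 2(1) in \<open>intro mult_mono power_mono; simp\<close>)
    moreover have "\<bar>d m\<bar> \<le> \<bar>D\<bar> * (R + S) ^ m"
      by (rule order.trans[OF 2(2)]) (use 1(1) 2(1) in \<open>intro mult_mono power_mono; simp\<close>)
    ultimately show ?thesis
      using abs_triangle_ineq[of "c m" "d m"] unfolding distrib_right by linarith
  qed
  then show ?thesis
    unfolding geo_bounded_def using 1(1) 2(1) by (intro exI[of _ "\<bar>C\<bar> + \<bar>D\<bar>"] exI[of _ "R + S"]) auto
qed

lemma geo_bounded_cmult:
  assumes "geo_bounded d"
  shows "geo_bounded (\<lambda>m. x * d m)"
proof -
  obtain C R where "0 \<le> R" "\<And>m. \<bar>d m\<bar> \<le> C * R ^ m"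
    using assms unfolding geo_bounded_def by blast
  then show ?thesis
    unfolding geo_bounded_def
    by (intro exI[of _ "\<bar>x\<bar> * C"] exI[of _ R]) (simp add: abs_mult mult.assoc mult_left_mono)
qed

lemma geo_bounded_zero: "geo_bounded (\<lambda>m. 0)"
  unfolding geo_bounded_def by (intro exI[of _ 0]) simp

lemma geo_bounded_sum:
  assumes "\<And>i. i \<in> A \<Longrightarrow> geo_bounded (d i)"
  shows "geo_bounded (\<lambda>m. \<Sum>i\<in>A. d i m)"
  using assms
proof (induction A rule: infinite_finite_induct)
  case (insert x F)
  have "geo_bounded (\<lambda>m. d x m + (\<Sum>i\<in>F. d i m))"
    by (intro geo_bounded_add insert.IH insert.prems) simp_all
  with insert.hyps show ?case by simp
qed (simp_all add: geo_bounded_zero)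

text \<open>These become the coefficients of the three-parameter Mittag-Leffler functions. The
  binomial is at most \<open>2 ^ m\<close>, and enlarging the base to
  \<open>1 + \<bar>x\<bar>\<close> allows the exponent \<open>m - k\<close> to be raised to
  \<open>m\<close>.\<close>

lemma geo_bounded_binomial: "geo_bounded (\<lambda>m. real (m choose k) * x ^ (m - k))"
proof -
  have "\<bar>real (m choose k) * x ^ (m - k)\<bar> \<le> 1 * (2 * (1 + \<bar>x\<bar>)) ^ m" for m
  proof -
    have "real (m choose k) \<le> 2 ^ m"
      using binomial_le_pow2[of m k] by (metis of_nat_le_iff of_nat_numeral of_nat_power)
    moreover have "\<bar>x\<bar> ^ (m - k) \<le> (1 + \<bar>x\<bar>) ^ (m - k)"
      by (intro power_mono) auto
    moreover have "(1 + \<bar>x\<bar>) ^ (m - k) \<le> (1 + \<bar>x\<bar>) ^ m"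
      by (intro power_increasing) auto
    ultimately have "real (m choose k) * \<bar>x\<bar> ^ (m - k) \<le> 2 ^ m * (1 + \<bar>x\<bar>) ^ m"
      by (intro mult_mono) auto
    then show ?thesis
      unfolding power_mult_distrib by (simp add: abs_mult power_abs)
  qed
  then show ?thesis
    unfolding geo_bounded_def by (intro exI[of _ 1] exI[of _ "2 * (1 + \<bar>x\<bar>)"]) auto
qed

section \<open>Riemann-Liouville integrals\<close>

definition rl_integral :: "real \<Rightarrow> (real \<Rightarrow> real) \<Rightarrow> real \<Rightarrow> real" where
  "rl_integral \<alpha> g t = 1 / Gamma \<alpha> * (LBINT s:{0<..<t}. (t - s) powr (\<alpha> - 1) * g s)"

text \<open>The point 0 is left out because the fractional series take a default value there. The
  bound does reach down to 0, which makes products with the singular kernel integrable.\<close>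

definition loc_bounded :: "(real \<Rightarrow> real) \<Rightarrow> bool" where
  "loc_bounded g \<longleftrightarrow> set_borel_measurable lborel {0<..} g \<and> (\<forall>T. \<exists>B. \<forall>s\<in>{0<..T}. \<bar>g s\<bar> \<le> B)"

text \<open>The Beta integral with \<open>u = 0\<close>: its Gamma factors cancel the normalization
  of \<open>frac_power\<close>, so that the kernel moves the family by one index.\<close>

lemma frac_power_kernel:
  assumes "\<alpha> > 0" "t > 0"
  shows "set_integrable lborel {0<..<t} (\<lambda>s. (t - s) powr (\<alpha> - 1) * frac_power \<alpha> m s)"
    and "(LBINT s:{0<..<t}. (t - s) powr (\<alpha> - 1) * frac_power \<alpha> m s) = Gamma \<alpha> * frac_power \<alpha> (Suc m) t"
proof -
  have pos: "real m * \<alpha> + 1 > 0" using assms by (intro add_nonneg_pos) auto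
  then have G: "Gamma (real m * \<alpha> + 1) > 0" by (rule Gamma_real_pos)
  have val: "1 / Gamma (real m * \<alpha> + 1) * (Beta (real m * \<alpha> + 1) \<alpha> * (t - 0) powr (\<alpha> + (real m * \<alpha> + 1) - 1))
      = Gamma \<alpha> * frac_power \<alpha> (Suc m) t"
    using G by (simp add: frac_power_def Beta_def field_simps)
  have "has_bochner_integral lborel
      (\<lambda>s. 1 / Gamma (real m * \<alpha> + 1) *
        (indicator {0<..<t} s * ((s - 0) powr (real m * \<alpha> + 1 - 1) * (t - s) powr (\<alpha> - 1))))
      (Gamma \<alpha> * frac_power \<alpha> (Suc m) t)"
    unfolding val[symmetric]
    by (intro has_bochner_integral_mult_right has_bochner_integral_Beta_interval assms pos)
  also have "(\<lambda>s. 1 / Gamma (real m * \<alpha> + 1) *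
        (indicator {0<..<t} s * ((s - 0) powr (real m * \<alpha> + 1 - 1) * (t - s) powr (\<alpha> - 1))))
     = (\<lambda>s. indicator {0<..<t} s *\<^sub>R ((t - s) powr (\<alpha> - 1) * frac_power \<alpha> m s))"
    by (auto simp: fun_eq_iff frac_power_def)
  finally show "set_integrable lborel {0<..<t} (\<lambda>s. (t - s) powr (\<alpha> - 1) * frac_power \<alpha> m s)"
    and "(LBINT s:{0<..<t}. (t - s) powr (\<alpha> - 1) * frac_power \<alpha> m s) = Gamma \<alpha> * frac_power \<alpha> (Suc m) t"
    unfolding set_integrable_def set_lebesgue_integral_def has_bochner_integral_iff by auto
qed

text \<open>Termwise integration is justified by absolute convergence: the integrals of the norms
  form a series in the shifted fractional powers.\<close>

lemma rl_integral_frac_series: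
  assumes "\<alpha> > 0" "t > 0" "geo_bounded d"
  shows "rl_integral \<alpha> (frac_series \<alpha> d) t = (\<Sum>m. d m * frac_power \<alpha> (Suc m) t)"
proof -
  define f where "f = (\<lambda>m s. d m * (indicator {0<..<t} s *\<^sub>R ((t - s) powr (\<alpha> - 1) * frac_power \<alpha> m s)))"
  have int: "integrable lborel (f m)" for m
    unfolding f_def using frac_power_kernel(1)[OF assms(1,2), of m] by (simp add: set_integrable_def)
  have normf: "norm (f m s) = \<bar>d m\<bar> * (indicator {0<..<t} s *\<^sub>R ((t - s) powr (\<alpha> - 1) * frac_power \<alpha> m s))" for m s
    unfolding f_def using frac_power_nonneg[OF assms(1)] by (simp add: abs_mult)
  have "(\<integral>s. norm (f m s) \<partial>lborel) = \<bar>d m\<bar> * (Gamma \<alpha> * frac_power \<alpha> (Suc m) t)" for m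
    unfolding normf using frac_power_kernel(2)[OF assms(1,2), of m] by (simp add: set_lebesgue_integral_def)
  moreover have "summable (\<lambda>m. \<bar>d m\<bar> * (Gamma \<alpha> * frac_power \<alpha> (Suc m) t))"
  proof -
    obtain C R where *: "0 \<le> R" "\<And>m. \<bar>d m\<bar> \<le> C * R ^ m"
      using assms(3) unfolding geo_bounded_def by blast
    \<comment> \<open>Shifting the coefficients by one index turns the series over
      \<open>frac_power \<alpha> (Suc m)\<close> into the tail of a series already known to
      converge.\<close>
    define d' where "d' = (\<lambda>m. case m of 0 \<Rightarrow> 0 | Suc m \<Rightarrow> d m)"
    have "C \<ge> 0" using *(2)[of 0] by simp
    have "\<bar>d' m\<bar> \<le> C * (R + 1) ^ m" for m
    proof (cases m)
      case (Suc k)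
      have "\<bar>d k\<bar> \<le> C * R ^ k" by (rule *)
      also have "\<dots> \<le> C * (R + 1) ^ k"
        using * \<open>C \<ge> 0\<close> by (intro mult_left_mono power_mono) auto
      also have "\<dots> \<le> C * (R + 1) ^ m"
        using * \<open>C \<ge> 0\<close> Suc by (intro mult_left_mono power_increasing) auto
      finally show ?thesis by (simp add: d'_def Suc)
    qed (use \<open>C \<ge> 0\<close> in \<open>simp add: d'_def\<close>)
    then have "geo_bounded d'"
      unfolding geo_bounded_def using * by (intro exI[of _ C] exI[of _ "R + 1"]) auto
    from geo_bounded_summable_abs[OF assms(1,2) this]
    have "summable (\<lambda>m. \<bar>d' (Suc m)\<bar> * frac_power \<alpha> (Suc m) t)"
      by (subst summable_Suc_iff)
    then have "summable (\<lambda>m. Gamma \<alpha> * (\<bar>d m\<bar> * frac_power \<alpha> (Suc m) t))"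
      by (intro summable_mult) (simp add: d'_def)
    then show ?thesis by (simp add: mult_ac)
  qed
  ultimately have sum: "summable (\<lambda>m. \<integral>s. norm (f m s) \<partial>lborel)"
    by simp
  have "summable (\<lambda>m. norm (f m s))" for s
  proof (cases "s \<in> {0<..<t}")
    case True
    then have "summable (\<lambda>m. (t - s) powr (\<alpha> - 1) * (\<bar>d m\<bar> * frac_power \<alpha> m s))"
      by (intro summable_mult geo_bounded_summable_abs assms) auto
    with True show ?thesis
      unfolding normf by (simp add: mult_ac)
  qed (simp add: f_def)
  then have "(\<integral>s. (\<Sum>m. f m s) \<partial>lborel) = (\<Sum>m. \<integral>s. f m s \<partial>lborel)"
    by (intro integral_suminf int sum) auto
  moreover have "(\<Sum>m. f m s) = indicator {0<..<t} s *\<^sub>R ((t - s) powr (\<alpha> - 1) * frac_series \<alpha> d s)" for s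
  proof (cases "s \<in> {0<..<t}")
    case True
    then have "summable (\<lambda>m. d m * frac_power \<alpha> m s)"
      by (intro geo_bounded_summable assms) auto
    from suminf_mult[OF this, of "(t - s) powr (\<alpha> - 1)"] True show ?thesis
      by (simp add: f_def frac_series_def mult_ac)
  qed (simp add: f_def)
  moreover have "(\<integral>s. f m s \<partial>lborel) = Gamma \<alpha> * (d m * frac_power \<alpha> (Suc m) t)" for m
    unfolding f_def using frac_power_kernel(2)[OF assms(1,2), of m] by (simp add: set_lebesgue_integral_def)
  moreover have "summable (\<lambda>m. d m * frac_power \<alpha> (Suc m) t)"
  proof -
    have "summable (\<lambda>m. \<bar>d m\<bar> * (Gamma \<alpha> * frac_power \<alpha> (Suc m) t) * (1 / Gamma \<alpha>))"
      by (rule summable_mult2) fact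
    moreover have "\<bar>d m\<bar> * (Gamma \<alpha> * frac_power \<alpha> (Suc m) t) * (1 / Gamma \<alpha>) = \<bar>d m * frac_power \<alpha> (Suc m) t\<bar>" for m
      using Gamma_real_pos[OF assms(1)] frac_power_nonneg[OF assms(1), of "Suc m" t] by (simp add: abs_mult)
    ultimately show ?thesis
      by (intro summable_rabs_cancel[of "\<lambda>m. d m * frac_power \<alpha> (Suc m) t"]) simp
  qed
  ultimately show ?thesis
    using Gamma_real_pos[OF assms(1)]
    by (simp add: rl_integral_def set_lebesgue_integral_def suminf_mult)
qed

text \<open>Fractional powers increase in time, so the absolute series at \<open>T\<close> bounds
  all earlier values.\<close>

lemma loc_bounded_frac_series:
  assumes "\<alpha> > 0" "geo_bounded d"
  shows "loc_bounded (frac_series \<alpha> d)"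
  unfolding loc_bounded_def
proof (intro conjI allI)
  show "set_borel_measurable lborel {0<..} (frac_series \<alpha> d)"
    unfolding set_borel_measurable_def by measurable
  fix T :: real
  show "\<exists>B. \<forall>s\<in>{0<..T}. \<bar>frac_series \<alpha> d s\<bar> \<le> B"
  proof (intro exI ballI)
    fix s assume s: "s \<in> {0<..T}"
    have 1: "summable (\<lambda>m. \<bar>d m * frac_power \<alpha> m s\<bar>)"
      using geo_bounded_summable_abs[OF assms(1) _ assms(2), of s] s frac_power_nonneg[OF assms(1)]
      by (simp add: abs_mult)
    then have "\<bar>frac_series \<alpha> d s\<bar> \<le> (\<Sum>m. \<bar>d m * frac_power \<alpha> m s\<bar>)"
      unfolding frac_series_def by (rule summable_rabs)
    also have "\<dots> \<le> (\<Sum>m. \<bar>d m\<bar> * frac_power \<alpha> m T)"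
    proof (rule suminf_le[OF _ 1])
      show "summable (\<lambda>m. \<bar>d m\<bar> * frac_power \<alpha> m T)"
        by (rule geo_bounded_summable_abs) (use assms s in auto)
      show "\<bar>d m * frac_power \<alpha> m s\<bar> \<le> \<bar>d m\<bar> * frac_power \<alpha> m T" for m
        using s frac_power_nonneg[OF assms(1), of m s] frac_power_mono[OF assms(1), of s T m]
        by (simp add: abs_mult mult_left_mono)
    qed
    finally show "\<bar>frac_series \<alpha> d s\<bar> \<le> (\<Sum>m. \<bar>d m\<bar> * frac_power \<alpha> m T)" .
  qed
qed

section \<open>Closure of local boundedness and integrability against the kernel\<close>

lemma loc_bounded_zero: "loc_bounded (\<lambda>s. 0)"
  unfolding loc_bounded_def set_borel_measurable_def by auto

lemma loc_bounded_cmult: "loc_bounded g \<Longrightarrow> loc_bounded (\<lambda>s. x * g s)"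
  unfolding loc_bounded_def set_borel_measurable_def
proof (elim conjE, intro conjI allI)
  assume [measurable]: "(\<lambda>s. indicator {0<..} s *\<^sub>R g s) \<in> borel_measurable lborel"
  have "(\<lambda>s. x * (indicator {0<..} s *\<^sub>R g s)) \<in> borel_measurable lborel"
    by measurable
  then show "(\<lambda>s. indicator {0<..} s *\<^sub>R (x * g s)) \<in> borel_measurable lborel"
    by (simp add: mult_ac)
  fix T :: real assume "\<forall>T. \<exists>B. \<forall>s\<in>{0<..T}. \<bar>g s\<bar> \<le> B"
  then obtain B where "\<forall>s\<in>{0<..T}. \<bar>g s\<bar> \<le> B" by blast
  then show "\<exists>B. \<forall>s\<in>{0<..T}. \<bar>x * g s\<bar> \<le> B"
    by (intro exI[of _ "\<bar>x\<bar> * B"]) (simp add: abs_mult mult_left_mono)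
qed

lemma loc_bounded_add:
  assumes "loc_bounded g" "loc_bounded h"
  shows "loc_bounded (\<lambda>s. g s + h s)"
  unfolding loc_bounded_def set_borel_measurable_def
proof (intro conjI allI)
  have [measurable]: "(\<lambda>s. indicator {0<..} s *\<^sub>R g s) \<in> borel_measurable lborel"
    "(\<lambda>s. indicator {0<..} s *\<^sub>R h s) \<in> borel_measurable lborel"
    using assms by (auto simp: loc_bounded_def set_borel_measurable_def)
  show "(\<lambda>s. indicator {0<..} s *\<^sub>R (g s + h s)) \<in> borel_measurable lborel"
    unfolding scaleR_add_right by measurable
  fix T :: real
  obtain B C where B: "\<forall>s\<in>{0<..T}. \<bar>g s\<bar> \<le> B" "\<forall>s\<in>{0<..T}. \<bar>h s\<bar> \<le> C"
    using assms unfolding loc_bounded_def by meson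
  have "\<bar>g s + h s\<bar> \<le> B + C" if "s \<in> {0<..T}" for s
    using B that abs_triangle_ineq[of "g s" "h s"] by fastforce
  then show "\<exists>B. \<forall>s\<in>{0<..T}. \<bar>g s + h s\<bar> \<le> B"
    by blast
qed

lemma loc_bounded_sum:
  assumes "\<And>i. i \<in> A \<Longrightarrow> loc_bounded (g i)"
  shows "loc_bounded (\<lambda>s. \<Sum>i\<in>A. g i s)"
  using assms
proof (induction A rule: infinite_finite_induct)
  case (insert x F)
  have "loc_bounded (\<lambda>s. g x s + (\<Sum>i\<in>F. g i s))"
    by (intro loc_bounded_add insert.IH insert.prems) simp_all
  with insert.hyps show ?case by simp
qed (simp_all add: loc_bounded_zero)

lemma loc_bounded_kernel_integrable:
  assumes "\<alpha> > 0" "t > 0" "loc_bounded g"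
  shows "set_integrable lborel {0<..<t} (\<lambda>s. (t - s) powr (\<alpha> - 1) * g s)"
proof -
  have [measurable]: "(\<lambda>s. indicator {0<..} s *\<^sub>R g s) \<in> borel_measurable lborel"
    using assms by (auto simp: loc_bounded_def set_borel_measurable_def)
  obtain B where B: "\<forall>s\<in>{0<..t}. \<bar>g s\<bar> \<le> B"
    using assms unfolding loc_bounded_def by meson
  \<comment> \<open>On the interval \<open>frac_power \<alpha> 0\<close> equals 1, so the majorant
    is a multiple of the bare kernel.\<close>
  have "set_integrable lborel {0<..<t} (\<lambda>s. B * ((t - s) powr (\<alpha> - 1) * frac_power \<alpha> 0 s))"
    using frac_power_kernel(1)[OF assms(1,2), of 0] by simp
  then show ?thesis
  proof (rule set_integrable_bound)
    have "(\<lambda>s. indicator {0<..<t} s * (t - s) powr (\<alpha> - 1) * (indicator {0<..} s *\<^sub>R g s)) \<in> borel_measurable lborel"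
      by measurable
    also have "(\<lambda>s. indicator {0<..<t} s * (t - s) powr (\<alpha> - 1) * (indicator {0<..} s *\<^sub>R g s))
       = (\<lambda>s. indicator {0<..<t} s *\<^sub>R ((t - s) powr (\<alpha> - 1) * g s))"
      by (auto simp: indicator_def)
    finally show "set_borel_measurable lborel {0<..<t} (\<lambda>s. (t - s) powr (\<alpha> - 1) * g s)"
      unfolding set_borel_measurable_def .
    have "norm ((t - s) powr (\<alpha> - 1) * g s) \<le> norm (B * ((t - s) powr (\<alpha> - 1) * frac_power \<alpha> 0 s))"
      if "s \<in> {0<..<t}" for s
    proof -
      have "\<bar>g s\<bar> \<le> \<bar>B\<bar>" using B that by force
      from mult_left_mono[OF this, of "(t - s) powr (\<alpha> - 1)"] that show ?thesis
        by (simp add: abs_mult frac_power_0 mult_ac)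
    qed
    then show "AE s in lborel. s \<in> {0<..<t} \<longrightarrow>
        norm ((t - s) powr (\<alpha> - 1) * g s) \<le> norm (B * ((t - s) powr (\<alpha> - 1) * frac_power \<alpha> 0 s))"
      by auto
  qed
qed

lemma rl_integral_diff:
  assumes "\<alpha> > 0" "t > 0" "loc_bounded g" "loc_bounded h"
  shows "rl_integral \<alpha> g t - rl_integral \<alpha> h t = rl_integral \<alpha> (\<lambda>s. g s - h s) t"
proof -
  have "(LBINT s:{0<..<t}. (t - s) powr (\<alpha> - 1) * g s) - (LBINT s:{0<..<t}. (t - s) powr (\<alpha> - 1) * h s)
      = (LBINT s:{0<..<t}. (t - s) powr (\<alpha> - 1) * g s - (t - s) powr (\<alpha> - 1) * h s)"
    by (rule set_integral_diff(2)[symmetric]; rule loc_bounded_kernel_integrable[OF assms(1,2)]) fact+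
  then show ?thesis
    by (simp add: rl_integral_def right_diff_distrib flip: diff_divide_distrib)
qed

lemma rl_integral_cong:
  assumes "\<And>s. 0 < s \<Longrightarrow> s < t \<Longrightarrow> g s = h s"
  shows "rl_integral \<alpha> g t = rl_integral \<alpha> h t"
  unfolding rl_integral_def
  by (intro arg_cong2[where f = "(*)"] refl set_lebesgue_integral_cong) (use assms in auto)

text \<open>A Gronwall argument: feeding a bound back into the equation replaces
  \<open>frac_power \<alpha> k\<close> by the next one and gains a factor
  \<open>\<bar>x\<bar>\<close>. In the limit the bound is 0.\<close>

lemma rl_integral_eigen_zero:
  assumes "\<alpha> > 0" "loc_bounded d" "\<And>t. t > 0 \<Longrightarrow> d t = rl_integral \<alpha> (\<lambda>s. x * d s) t" "t > 0"
  shows "d t = 0"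
proof -
  obtain B where B: "\<forall>s\<in>{0<..t}. \<bar>d s\<bar> \<le> B"
    using assms unfolding loc_bounded_def by meson
  \<comment> \<open>The bound is needed at all \<open>s\<close> up to \<open>t\<close>, since the
    induction step integrates over earlier times; \<open>B\<close> stays fixed.\<close>
  have *: "\<bar>d s\<bar> \<le> B * \<bar>x\<bar> ^ k * frac_power \<alpha> k s" if "0 < s" "s \<le> t" for s k
    using that
  proof (induction k arbitrary: s)
    case 0
    then show ?case using B by (simp add: frac_power_0)
  next
    case (Suc k)
    let ?K = "\<lambda>u. (s - u) powr (\<alpha> - 1)"
    have 1: "set_integrable lborel {0<..<s} (\<lambda>u. ?K u * (x * d u))"
      by (intro loc_bounded_kernel_integrable loc_bounded_cmult assms Suc)
    have 2: "set_integrable lborel {0<..<s} (\<lambda>u. (\<bar>x\<bar> * (B * \<bar>x\<bar> ^ k)) * (?K u * frac_power \<alpha> k u))"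
      using frac_power_kernel(1)[OF assms(1) Suc.prems(1)] by simp
    have "\<bar>LBINT u:{0<..<s}. ?K u * (x * d u)\<bar> \<le> (LBINT u:{0<..<s}. \<bar>?K u * (x * d u)\<bar>)"
      using set_integral_norm_bound[OF 1] by simp
    also have "\<dots> \<le> (LBINT u:{0<..<s}. (\<bar>x\<bar> * (B * \<bar>x\<bar> ^ k)) * (?K u * frac_power \<alpha> k u))"
    proof (rule set_integral_mono[OF set_integrable_abs[OF 1] 2])
      fix u assume u: "u \<in> {0<..<s}"
      then have "\<bar>d u\<bar> \<le> B * \<bar>x\<bar> ^ k * frac_power \<alpha> k u"
        using Suc by auto
      then have "?K u * (\<bar>x\<bar> * \<bar>d u\<bar>) \<le> ?K u * (\<bar>x\<bar> * (B * \<bar>x\<bar> ^ k * frac_power \<alpha> k u))"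
        by (intro mult_left_mono) auto
      then show "\<bar>?K u * (x * d u)\<bar> \<le> (\<bar>x\<bar> * (B * \<bar>x\<bar> ^ k)) * (?K u * frac_power \<alpha> k u)"
        by (simp add: abs_mult mult_ac)
    qed
    also have "\<dots> = (\<bar>x\<bar> * (B * \<bar>x\<bar> ^ k)) * (Gamma \<alpha> * frac_power \<alpha> (Suc k) s)"
      unfolding set_integral_mult_right frac_power_kernel(2)[OF assms(1) Suc.prems(1)] ..
    finally have "\<bar>LBINT u:{0<..<s}. ?K u * (x * d u)\<bar> \<le> (\<bar>x\<bar> * (B * \<bar>x\<bar> ^ k)) * (Gamma \<alpha> * frac_power \<alpha> (Suc k) s)" .
    then have "\<bar>LBINT u:{0<..<s}. ?K u * (x * d u)\<bar> / Gamma \<alpha> \<le> (\<bar>x\<bar> * (B * \<bar>x\<bar> ^ k)) * (Gamma \<alpha> * frac_power \<alpha> (Suc k) s) / Gamma \<alpha>"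
      using Gamma_real_pos[OF assms(1)] by (intro divide_right_mono) auto
    then have "\<bar>rl_integral \<alpha> (\<lambda>u. x * d u) s\<bar> \<le> B * \<bar>x\<bar> ^ Suc k * frac_power \<alpha> (Suc k) s"
      using Gamma_real_pos[OF assms(1)] by (simp add: rl_integral_def abs_mult mult_ac)
    then show ?case
      using assms(3)[OF Suc.prems(1)] by simp
  qed
  have "(\<lambda>k. \<bar>x\<bar> ^ k * frac_power \<alpha> k t) \<longlonglongrightarrow> 0"
    by (intro summable_LIMSEQ_zero summable_power_frac_power assms) simp
  then have "(\<lambda>k. B * (\<bar>x\<bar> ^ k * frac_power \<alpha> k t)) \<longlonglongrightarrow> B * 0"
    by (intro tendsto_intros)
  then have "\<bar>d t\<bar> \<le> B * 0"
    by (rule LIMSEQ_le_const) (use *[OF assms(4) order.refl] in \<open>auto simp: mult.assoc\<close>)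
  then show ?thesis by simp
qed

section \<open>Inverting the Dzhrbashyan-Caputo derivative\<close>

text \<open>The derivative may blow up at 0, so the fundamental theorem is applied in its interior
  form, for the gauge integral. Integrability then identifies that integral with the Lebesgue
  integral.\<close>

lemma integral_deriv_interior:
  fixes f :: "real \<Rightarrow> real"
  assumes "continuous_on {0..} f" "\<And>t. t > 0 \<Longrightarrow> f differentiable (at t)"
    and "t > 0" "set_integrable lborel {0<..<t} (deriv f)"
  shows "(LBINT s:{0<..<t}. deriv f s) = f t - f 0"
proof -
  have "(deriv f has_integral (f t - f 0)) {0..t}"
  proof (rule fundamental_theorem_of_calculus_interior)
    show "continuous_on {0..t} f"
      by (rule continuous_on_subset[OF assms(1)]) auto
    fix x assume "x \<in> {0<..<t}"
    then have "(f has_field_derivative deriv f x) (at x)"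
      using assms(2)[of x] by (simp add: DERIV_deriv_iff_real_differentiable)
    then show "(f has_vector_derivative deriv f x) (at x)"
      by (simp add: has_real_derivative_iff_has_vector_derivative)
  qed (use assms in auto)
  then show ?thesis
    unfolding set_borel_integral_eq_integral(2)[OF assms(4)]
    by (simp add: integral_unique flip: integral_open_interval_real)
qed

text \<open>On the interval the kernel is bounded below by \<open>t powr (-\<alpha>)\<close>, so
  integrability with the kernel implies integrability without it.\<close>

lemma caputo_deriv_set_integrable:
  fixes h :: "real \<Rightarrow> real"
  assumes "0 < \<alpha>" "\<alpha> < 1" "t > 0"
    and "set_integrable lborel {0<..<t} (\<lambda>s. (t - s) powr (-\<alpha>) * h s)"
  shows "set_integrable lborel {0<..<t} h"
proof -
  have [measurable]: "(\<lambda>s. indicator {0<..<t} s *\<^sub>R ((t - s) powr (-\<alpha>) * h s)) \<in> borel_measurable lborel"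
    using assms(4) unfolding set_integrable_def by (rule borel_measurable_integrable)
  \<comment> \<open>Multiplying the kernel away recovers the measurability of \<open>h\<close> from
    that of the product.\<close>
  have eq: "indicator {0<..<t} s *\<^sub>R h s
      = (t - s) powr \<alpha> * (indicator {0<..<t} s *\<^sub>R ((t - s) powr (-\<alpha>) * h s))" for s
  proof (cases "s < t")
    case True
    then have "(t - s) powr \<alpha> * (t - s) powr (-\<alpha>) = 1"
      using powr_add[of "t - s" \<alpha> "- \<alpha>"] by simp
    then have "(t - s) powr \<alpha> * ((t - s) powr (-\<alpha>) * h s) = h s"
      by (simp flip: mult.assoc)
    then show ?thesis
      by (simp add: indicator_def)
  qed simp
  have "set_integrable lborel {0<..<t} (\<lambda>s. t powr \<alpha> * ((t - s) powr (-\<alpha>) * h s))"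
    using assms(4) by simp
  then show ?thesis
  proof (rule set_integrable_bound)
    show "set_borel_measurable lborel {0<..<t} h"
      unfolding set_borel_measurable_def eq by measurable
    have "norm (h s) \<le> norm (t powr \<alpha> * ((t - s) powr (-\<alpha>) * h s))" if "s \<in> {0<..<t}" for s
    proof -
      have "(t - s) powr \<alpha> * (t - s) powr (-\<alpha>) = 1"
        using that powr_add[of "t - s" \<alpha> "- \<alpha>"] by simp
      then have "1 \<le> t powr \<alpha> * (t - s) powr (-\<alpha>)"
        using that assms mult_right_mono[of "(t - s) powr \<alpha>" "t powr \<alpha>" "(t - s) powr (-\<alpha>)"]
        by (simp add: powr_mono2)
      from mult_right_mono[OF this, of "\<bar>h s\<bar>"] show ?thesis
        by (simp add: abs_mult mult_ac)
    qed
    then show "AE s in lborel. s \<in> {0<..<t} \<longrightarrow> norm (h s) \<le> norm (t powr \<alpha> * ((t - s) powr (-\<alpha>) * h s))"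
      by auto
  qed
qed

text \<open>The semigroup law for fractional integrals of orders \<open>\<alpha>\<close> and
  \<open>1 - \<alpha>\<close>. After Fubini the inner integral is
  \<open>Beta (1 - \<alpha>) \<alpha>\<close>, independent of \<open>u\<close>, because the power of
  \<open>t - u\<close> has exponent 0.\<close>

lemma rl_integral_caputo_kernel:
  assumes "0 < \<alpha>" "\<alpha> < 1" "t > 0" "set_integrable lborel {0<..<t} h"
  shows "rl_integral \<alpha> (\<lambda>s. 1 / Gamma (1 - \<alpha>) * (LBINT u:{0<..<s}. (s - u) powr (-\<alpha>) * h u)) t
    = (LBINT u:{0<..<t}. h u)"
proof -
  define k where "k u = indicator {0<..<t} u *\<^sub>R h u" for u
  have k: "integrable lborel k"
    using assms(4) unfolding k_def set_integrable_def .
  then have [measurable]: "k \<in> borel_measurable borel"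
    by (auto dest: borel_measurable_integrable)
  \<comment> \<open>The conditional, in place of an indicator of an interval depending on
    \<open>u\<close>, makes joint measurability in \<open>u\<close> and \<open>s\<close>
    accessible.\<close>
  define F where "F u s = k u * (if u < s \<and> s < t then (s - u) powr (-\<alpha>) * (t - s) powr (\<alpha> - 1) else 0)"
    for u s
  have ind: "(if u < s \<and> s < t then (s - u) powr (-\<alpha>) * (t - s) powr (\<alpha> - 1) else 0)
      = indicator {u<..<t} s * ((s - u) powr ((1 - \<alpha>) - 1) * (t - s) powr (\<alpha> - 1))" for u s
    by simp
  have beta: "has_bochner_integral lborel
      (\<lambda>s. if u < s \<and> s < t then (s - u) powr (-\<alpha>) * (t - s) powr (\<alpha> - 1) else 0) (Beta (1 - \<alpha>) \<alpha>)"
    if "u < t" for u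
    unfolding ind using has_bochner_integral_Beta_interval[of \<alpha> "1 - \<alpha>" u t] that assms by simp
  have k0: "k u = 0" if "\<not> u < t" for u
    using that by (simp add: k_def)
  have F_int: "has_bochner_integral lborel (F u) (k u * Beta (1 - \<alpha>) \<alpha>)" for u
  proof (cases "u < t")
    case True
    show ?thesis unfolding F_def by (rule has_bochner_integral_mult_right[OF beta[OF True]])
  next
    case False
    then have "F u = (\<lambda>s. 0)"
      by (auto simp: fun_eq_iff F_def k0)
    with False show ?thesis
      using has_bochner_integral_zero[of lborel] by (simp add: k0)
  qed
  have F_norm: "(\<integral>s. norm (F u s) \<partial>lborel) = \<bar>k u\<bar> * Beta (1 - \<alpha>) \<alpha>" for u
  proof (cases "u < t")
    case True
    have "norm (F u s) = \<bar>k u\<bar> * (if u < s \<and> s < t then (s - u) powr (-\<alpha>) * (t - s) powr (\<alpha> - 1) else 0)" for s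
      by (simp add: F_def abs_mult)
    then show ?thesis
      using has_bochner_integral_integral_eq[OF has_bochner_integral_mult_right[OF beta[OF True], of "\<bar>k u\<bar>"]]
      by simp
  qed (simp add: F_def k0)
  have "integrable (lborel \<Otimes>\<^sub>M lborel) (case_prod F)"
  proof (rule lborel_pair.Fubini_integrable)
    show "case_prod F \<in> borel_measurable (lborel \<Otimes>\<^sub>M lborel)"
      unfolding F_def case_prod_beta by measurable
    show "integrable lborel (\<lambda>u. \<integral>s. norm (case_prod F (u, s)) \<partial>lborel)"
      unfolding prod.case F_norm using k by (intro integrable_mult_left integrable_abs)
    show "AE u in lborel. integrable lborel (\<lambda>s. case_prod F (u, s))"
      unfolding prod.case using F_int by (auto simp: has_bochner_integral_iff)
  qed
  from lborel_pair.Fubini_integral[OF this]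
  have "(\<integral>s. (\<integral>u. F u s \<partial>lborel) \<partial>lborel) = (\<integral>u. (\<integral>s. F u s \<partial>lborel) \<partial>lborel)" .
  also have "\<dots> = (\<integral>u. k u \<partial>lborel) * Beta (1 - \<alpha>) \<alpha>"
    unfolding has_bochner_integral_integral_eq[OF F_int] by simp
  also have "(\<lambda>s. \<integral>u. F u s \<partial>lborel)
      = (\<lambda>s. indicator {0<..<t} s *\<^sub>R ((t - s) powr (\<alpha> - 1) * (LBINT u:{0<..<s}. (s - u) powr (-\<alpha>) * h u)))"
  proof
    fix s
    show "(\<integral>u. F u s \<partial>lborel)
      = indicator {0<..<t} s *\<^sub>R ((t - s) powr (\<alpha> - 1) * (LBINT u:{0<..<s}. (s - u) powr (-\<alpha>) * h u))"
    proof (cases "s \<in> {0<..<t}")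
      case True
      then have "F u s = (t - s) powr (\<alpha> - 1) * (indicator {0<..<s} u *\<^sub>R ((s - u) powr (-\<alpha>) * h u))" for u
        by (auto simp: F_def k_def indicator_def)
      with True show ?thesis by (simp add: set_lebesgue_integral_def)
    next
      case False
      then have "F u s = 0" for u
        by (auto simp: F_def k_def indicator_def)
      with False show ?thesis by simp
    qed
  qed
  finally have "(LBINT s:{0<..<t}. (t - s) powr (\<alpha> - 1) * (LBINT u:{0<..<s}. (s - u) powr (-\<alpha>) * h u))
      = (LBINT u:{0<..<t}. h u) * (Gamma (1 - \<alpha>) * Gamma \<alpha>)"
    by (simp add: set_lebesgue_integral_def k_def Beta_def)
  moreover have "(t - s) powr (\<alpha> - 1) * (1 / Gamma (1 - \<alpha>) * (LBINT u:{0<..<s}. (s - u) powr (-\<alpha>) * h u))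
      = 1 / Gamma (1 - \<alpha>) * ((t - s) powr (\<alpha> - 1) * (LBINT u:{0<..<s}. (s - u) powr (-\<alpha>) * h u))" for s
    by simp
  moreover have "Gamma \<alpha> > 0" "Gamma (1 - \<alpha>) > 0"
    using assms by (auto intro: Gamma_real_pos)
  ultimately show ?thesis
    unfolding rl_integral_def by (simp only: set_integral_mult_right) simp
qed

text \<open>This converts the differential equation with its initial value into a Volterra equation:
  by the fundamental theorem for \<open>\<alpha> = 1\<close>, and preceded by the Fubini argument
  for \<open>\<alpha> < 1\<close>.\<close>

lemma rl_integral_caputo_deriv:
  assumes "0 < \<alpha>" "\<alpha> \<le> 1" "t > 0" "caputo_differentiable \<alpha> f"
    and "loc_bounded g" "\<And>s. s > 0 \<Longrightarrow> caputo_deriv \<alpha> f s = g s"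
  shows "f t = f 0 + rl_integral \<alpha> g t"
proof -
  have f: "continuous_on {0..} f" "\<And>t. t > 0 \<Longrightarrow> f differentiable (at t)"
    using assms(4) by (auto simp: caputo_differentiable_def)
  show ?thesis
  proof (cases "\<alpha> = 1")
    case True
    have g: "g s = deriv f s" if "s > 0" for s
      using assms(6)[OF that] True by (simp add: caputo_deriv_def)
    have eq: "(t - s) powr (\<alpha> - 1) * g s = deriv f s" if "s \<in> {0<..<t}" for s
      using that True g by simp
    \<comment> \<open>For \<open>\<alpha> = 1\<close>, \<open>caputo_differentiable\<close> does not
      include integrability of the derivative; it comes from the bounds on \<open>g\<close>, the
      kernel being 1.\<close>
    have int: "set_integrable lborel {0<..<t} (\<lambda>s. (t - s) powr (\<alpha> - 1) * g s)"
      by (rule loc_bounded_kernel_integrable) (use assms in auto)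
    have "set_integrable lborel {0<..<t} (deriv f) = set_integrable lborel {0<..<t} (\<lambda>s. (t - s) powr (\<alpha> - 1) * g s)"
      by (rule set_integrable_cong) (simp_all only: eq)
    with int have "(LBINT s:{0<..<t}. deriv f s) = f t - f 0"
      by (intro integral_deriv_interior f assms(3)) simp_all
    moreover have "(LBINT s:{0<..<t}. (t - s) powr (\<alpha> - 1) * g s) = (LBINT s:{0<..<t}. deriv f s)"
      using eq by (intro set_lebesgue_integral_cong allI impI) simp_all
    ultimately have "rl_integral \<alpha> g t = 1 / Gamma \<alpha> * (f t - f 0)"
      by (simp only: rl_integral_def)
    then show ?thesis
      using True by simp
  next
    case False
    then have "\<alpha> < 1" using assms by simp
    have int: "set_integrable lborel {0<..<t} (deriv f)"
      by (rule caputo_deriv_set_integrable[of \<alpha>])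
        (use assms \<open>\<alpha> < 1\<close> in \<open>auto simp: caputo_differentiable_def\<close>)
    have "rl_integral \<alpha> g t
      = rl_integral \<alpha> (\<lambda>s. 1 / Gamma (1 - \<alpha>) * (LBINT u:{0<..<s}. (s - u) powr (-\<alpha>) * deriv f u)) t"
      by (rule rl_integral_cong) (use False in \<open>simp add: caputo_deriv_def flip: assms(6)\<close>)
    also have "\<dots> = f t - f 0"
      using rl_integral_caputo_kernel[OF assms(1) \<open>\<alpha> < 1\<close> assms(3) int] integral_deriv_interior[OF f assms(3) int]
      by simp
    finally show ?thesis by simp
  qed
qed

section \<open>Sums over partitions\<close>

text \<open>The length \<open>N\<close> of the tuples is decoupled from \<open>n\<close>, because the recursion in \<open>n\<close> and \<open>k\<close>
  removes a part while leaving the index set alone.\<close>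
definition partition_tuples :: "nat \<Rightarrow> nat \<Rightarrow> nat \<Rightarrow> (nat \<Rightarrow> nat) set" where
  "partition_tuples N n k =
     {\<kappa> \<in> {1..N} \<rightarrow>\<^sub>E UNIV. (\<Sum>j=1..N. \<kappa> j) = k \<and> (\<Sum>j=1..N. j * \<kappa> j) = n}"

definition partition_weight :: "(nat \<Rightarrow> real) \<Rightarrow> nat \<Rightarrow> (nat \<Rightarrow> nat) \<Rightarrow> real" where
  "partition_weight a N \<kappa> = (\<Prod>j=1..N. a j ^ \<kappa> j / fact (\<kappa> j))"

text \<open>By the multinomial theorem this is the coefficient of \<open>z ^ n\<close> in
  \<open>(\<Sum>j=1..N. a j * z ^ j) ^ k\<close>.\<close>

definition partition_sum :: "(nat \<Rightarrow> real) \<Rightarrow> nat \<Rightarrow> nat \<Rightarrow> nat \<Rightarrow> real" where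
  "partition_sum a N n k = (\<Sum>\<kappa>\<in>partition_tuples N n k. fact k * partition_weight a N \<kappa>)"

lemma partition_tuples_Theta: "partition_tuples n n k = Theta n k"
  by (simp add: partition_tuples_def Theta_def)

lemma partition_weight_Suc:
  assumes "j \<in> {1..N}"
  shows "real (Suc (\<kappa> j)) * partition_weight a N (\<kappa>(j := Suc (\<kappa> j))) = a j * partition_weight a N \<kappa>"
proof -
  have "(\<Prod>i\<in>{1..N} - {j}. a i ^ (\<kappa>(j := Suc (\<kappa> j))) i / fact ((\<kappa>(j := Suc (\<kappa> j))) i))
      = (\<Prod>i\<in>{1..N} - {j}. a i ^ \<kappa> i / fact (\<kappa> i))"
    by (intro prod.cong) auto
  moreover have "prod f {1..N} = f j * prod f ({1..N} - {j})" for f :: "nat \<Rightarrow> real"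
    by (rule prod.remove) (use assms in auto)
  ultimately show ?thesis
    unfolding partition_weight_def by (simp add: field_simps del: of_nat_Suc)
qed

text \<open>One more part \<open>j\<close> raises the number of parts by 1 and the weighted sum by
  \<open>j\<close>. The condition \<open>j \<le> n\<close> is explicit because \<open>n - j\<close>
  truncates.\<close>

lemma partition_tuples_Suc_iff:
  assumes "j \<in> {1..N}" "\<kappa> \<in> extensional {1..N}"
  shows "\<kappa>(j := Suc (\<kappa> j)) \<in> partition_tuples N n (Suc k) \<longleftrightarrow> j \<le> n \<and> \<kappa> \<in> partition_tuples N (n - j) k"
proof -
  have e: "(\<kappa>(j := Suc (\<kappa> j))) i = \<kappa> i + (if i = j then 1 else 0)" for i
    by simp
  have "(\<Sum>i=1..N. (\<kappa>(j := Suc (\<kappa> j))) i) = Suc (\<Sum>i=1..N. \<kappa> i)"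
    using assms unfolding e by (simp add: sum.distrib)
  moreover have "(\<Sum>i=1..N. i * (\<kappa>(j := Suc (\<kappa> j))) i) = (\<Sum>i=1..N. i * \<kappa> i) + j"
  proof -
    have "i * (\<kappa>(j := Suc (\<kappa> j))) i = i * \<kappa> i + (if i = j then j else 0)" for i
      by simp
    then show ?thesis
      using assms by (simp only: sum.distrib) simp
  qed
  moreover have "\<kappa>(j := Suc (\<kappa> j)) \<in> extensional {1..N}"
    using assms by (auto simp: extensional_def)
  ultimately show ?thesis
    using assms(2) by (auto simp: partition_tuples_def PiE_def)
qed

lemma finite_partition_tuples: "finite (partition_tuples N n k)"
proof (rule finite_subset)
  show "finite ({1..N} \<rightarrow>\<^sub>E {..k})"
    by (intro finite_PiE) auto
  show "partition_tuples N n k \<subseteq> {1..N} \<rightarrow>\<^sub>E {..k}"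
    unfolding partition_tuples_def by (auto simp: PiE_iff extensional_def intro: member_le_sum)
qed

lemma partition_sum_Suc:
  "partition_sum a N n (Suc k) = (\<Sum>j=1..N. if j \<le> n then a j * partition_sum a N (n - j) k else 0)"
proof -
  let ?T = "partition_tuples N n (Suc k)"
  \<comment> \<open>One factor of \<open>fact (Suc k)\<close> is \<open>\<Sum>j. \<kappa> j\<close>, and \<open>\<kappa> j\<close> cancels against \<open>fact (\<kappa> j)\<close> when a part \<open>j\<close> is removed.\<close>
  have "partition_sum a N n (Suc k) = (\<Sum>\<kappa>\<in>?T. \<Sum>j=1..N. fact k * (real (\<kappa> j) * partition_weight a N \<kappa>))"
    unfolding partition_sum_def
  proof (rule sum.cong[OF refl])
    fix \<kappa> assume "\<kappa> \<in> ?T"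
    then have "real (Suc k) = (\<Sum>j=1..N. real (\<kappa> j))"
      by (simp add: partition_tuples_def flip: of_nat_sum)
    then show "fact (Suc k) * partition_weight a N \<kappa> = (\<Sum>j=1..N. fact k * (real (\<kappa> j) * partition_weight a N \<kappa>))"
      unfolding fact_Suc by (simp add: sum_distrib_left sum_distrib_right mult_ac del: of_nat_Suc)
  qed
  also have "\<dots> = (\<Sum>j=1..N. \<Sum>\<kappa>\<in>?T. fact k * (real (\<kappa> j) * partition_weight a N \<kappa>))"
    by (rule sum.swap)
  also have "\<dots> = (\<Sum>j=1..N. if j \<le> n then a j * partition_sum a N (n - j) k else 0)"
  proof (rule sum.cong[OF refl])
    fix j assume j: "j \<in> {1..N}"
    have upd: "\<kappa> = (\<kappa>(j := \<kappa> j - 1))(j := Suc ((\<kappa>(j := \<kappa> j - 1)) j))" if "\<kappa> j \<noteq> 0" for \<kappa> :: "nat \<Rightarrow> nat"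
      using that by simp
    have ext: "\<kappa>(j := x) \<in> extensional {1..N}" if "\<kappa> \<in> partition_tuples N n' k'" for \<kappa> x n' k'
      using that j by (auto simp: partition_tuples_def PiE_def extensional_def)
    \<comment> \<open>Tuples without a part \<open>j\<close> contribute 0; on the others
      \<open>\<kappa> j - 1\<close> is a true predecessor.\<close>
    have "(\<Sum>\<kappa>\<in>?T. fact k * (real (\<kappa> j) * partition_weight a N \<kappa>))
        = (\<Sum>\<kappa>\<in>{\<kappa>\<in>?T. \<kappa> j \<noteq> 0}. fact k * (real (\<kappa> j) * partition_weight a N \<kappa>))"
      by (rule sum.mono_neutral_right) (auto simp: finite_partition_tuples)
    also have "\<dots> = (\<Sum>\<kappa>\<in>(if j \<le> n then partition_tuples N (n - j) k else {}). a j * (fact k * partition_weight a N \<kappa>))"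
    proof (rule sum.reindex_bij_witness[of _ "\<lambda>\<kappa>. \<kappa>(j := Suc (\<kappa> j))" "\<lambda>\<kappa>. \<kappa>(j := \<kappa> j - 1)"])
      fix \<kappa> assume "\<kappa> \<in> {\<kappa>\<in>?T. \<kappa> j \<noteq> 0}"
      then have \<kappa>: "\<kappa> \<in> ?T" "\<kappa> j \<noteq> 0" by auto
      define \<kappa>' where "\<kappa>' = \<kappa>(j := \<kappa> j - 1)"
      have eq: "\<kappa> = \<kappa>'(j := Suc (\<kappa>' j))"
        unfolding \<kappa>'_def by (rule upd) fact
      show "(\<kappa>(j := \<kappa> j - 1))(j := Suc ((\<kappa>(j := \<kappa> j - 1)) j)) = \<kappa>"
        using \<kappa> by simp
      have "j \<le> n \<and> \<kappa>' \<in> partition_tuples N (n - j) k"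
        using \<kappa>(1) partition_tuples_Suc_iff[OF j, of \<kappa>' n k] ext[OF \<kappa>(1)] eq \<kappa>'_def by metis
      then show "\<kappa>(j := \<kappa> j - 1) \<in> (if j \<le> n then partition_tuples N (n - j) k else {})"
        by (simp add: \<kappa>'_def)
      have "\<kappa> j = Suc (\<kappa>' j)" using \<kappa> by (simp add: \<kappa>'_def)
      then have "a j * partition_weight a N \<kappa>' = real (\<kappa> j) * partition_weight a N \<kappa>"
        using partition_weight_Suc[OF j, of \<kappa>' a] eq by metis
      then show "a j * (fact k * partition_weight a N (\<kappa>(j := \<kappa> j - 1))) = fact k * (real (\<kappa> j) * partition_weight a N \<kappa>)"
        by (simp add: \<kappa>'_def)
    next
      fix \<kappa> assume "\<kappa> \<in> (if j \<le> n then partition_tuples N (n - j) k else {})"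
      then have \<kappa>: "j \<le> n" "\<kappa> \<in> partition_tuples N (n - j) k" by (auto split: if_splits)
      show "(\<kappa>(j := Suc (\<kappa> j)))(j := (\<kappa>(j := Suc (\<kappa> j))) j - 1) = \<kappa>"
        by simp
      show "\<kappa>(j := Suc (\<kappa> j)) \<in> {\<kappa>\<in>?T. \<kappa> j \<noteq> 0}"
        using partition_tuples_Suc_iff[OF j, of \<kappa> n k] \<kappa> ext[OF \<kappa>(2), of "\<kappa> j"] by simp
    qed
    also have "\<dots> = (if j \<le> n then a j * partition_sum a N (n - j) k else 0)"
      by (simp add: partition_sum_def sum_distrib_left)
    finally show "(\<Sum>\<kappa>\<in>?T. fact k * (real (\<kappa> j) * partition_weight a N \<kappa>))
        = (if j \<le> n then a j * partition_sum a N (n - j) k else 0)" .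
  qed
  finally show ?thesis .
qed

lemma partition_tuples_zero:
  assumes "\<kappa> \<in> partition_tuples N n k" "j \<in> {1..N}" "n < j"
  shows "\<kappa> j = 0"
proof -
  have "j * \<kappa> j \<le> (\<Sum>i=1..N. i * \<kappa> i)"
    using assms by (intro member_le_sum) auto
  with assms have "j * \<kappa> j \<le> n" by (simp add: partition_tuples_def)
  with assms show ?thesis by (cases "\<kappa> j") auto
qed

text \<open>Parts larger than \<open>n\<close> cannot occur, so restriction and extension by zeros
  are mutually inverse, and the extra factors of the weight are 1.\<close>

lemma partition_sum_diagonal:
  assumes "n \<le> N"
  shows "partition_sum a N n k = partition_sum a n n k"
  unfolding partition_sum_def
proof (rule sum.reindex_bij_witness[of _
    \<comment> \<open>The third case restores the value that extensional functions have outside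
      \<open>{1..N}\<close>.\<close>
    "\<lambda>\<kappa> j. if j \<in> {1..n} then \<kappa> j else if j \<in> {1..N} then 0 else undefined" "\<lambda>\<kappa>. restrict \<kappa> {1..n}"])
  have sub: "{1..n} \<subseteq> {1..N}" using assms by auto
  {
    fix \<kappa> assume \<kappa>: "\<kappa> \<in> partition_tuples N n k"
    have z: "\<kappa> j = 0" if "j \<in> {1..N} - {1..n}" for j
      by (rule partition_tuples_zero[OF \<kappa>]) (use that in auto)
    show "(\<lambda>j. if j \<in> {1..n} then restrict \<kappa> {1..n} j else if j \<in> {1..N} then 0 else undefined) = \<kappa>"
      using \<kappa> z by (auto simp: fun_eq_iff partition_tuples_def PiE_def extensional_def)
    have "(\<Sum>j=1..n. restrict \<kappa> {1..n} j) = (\<Sum>j=1..N. \<kappa> j)"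
      by (rule sum.mono_neutral_cong_left) (use sub z in auto)
    moreover have "(\<Sum>j=1..n. j * restrict \<kappa> {1..n} j) = (\<Sum>j=1..N. j * \<kappa> j)"
      by (rule sum.mono_neutral_cong_left) (use sub z in auto)
    ultimately show "restrict \<kappa> {1..n} \<in> partition_tuples n n k"
      using \<kappa> by (auto simp: partition_tuples_def)
    show "fact k * partition_weight a n (restrict \<kappa> {1..n}) = fact k * partition_weight a N \<kappa>"
      unfolding partition_weight_def
      by (intro arg_cong2[where f = "(*)"] refl prod.mono_neutral_cong_left) (use sub z in auto)
  }
  {
    fix \<kappa> assume \<kappa>: "\<kappa> \<in> partition_tuples n n k"
    let ?\<kappa> = "\<lambda>j. if j \<in> {1..n} then \<kappa> j else if j \<in> {1..N} then 0 else undefined"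
    show "restrict ?\<kappa> {1..n} = \<kappa>"
      using \<kappa> by (auto simp: fun_eq_iff partition_tuples_def PiE_def extensional_def)
    have "(\<Sum>j=1..N. ?\<kappa> j) = (\<Sum>j=1..n. \<kappa> j)"
      by (rule sum.mono_neutral_cong_right) (use sub in auto)
    moreover have "(\<Sum>j=1..N. j * ?\<kappa> j) = (\<Sum>j=1..n. j * \<kappa> j)"
      by (rule sum.mono_neutral_cong_right) (use sub in auto)
    ultimately show "?\<kappa> \<in> partition_tuples N n k"
      using \<kappa> sub by (auto simp: partition_tuples_def PiE_def extensional_def)
  }
qed

abbreviation "theta_sum a n k \<equiv> partition_sum a n n k"

text \<open>Removing a part leaves tuples of length \<open>n\<close> for the total
  \<open>n - j\<close>; the previous lemma shortens them to their natural length.\<close>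

lemma theta_sum_Suc: "theta_sum a n (Suc k) = (\<Sum>j=1..n. a j * theta_sum a (n - j) k)"
  unfolding partition_sum_Suc
  by (intro sum.cong) (auto simp: partition_sum_diagonal[of "n - _" n])

lemma theta_sum_0: "theta_sum a n 0 = (if n = 0 then 1 else 0)"
proof (cases "n = 0")
  case True
  \<comment> \<open>This function represents the empty tuple.\<close>
  then have "partition_tuples n n 0 = {\<lambda>_. undefined}"
    by (auto simp: partition_tuples_def)
  with True show ?thesis by (simp add: partition_sum_def partition_weight_def)
next
  case False
  then have "partition_tuples n n 0 = {}"
    by (auto simp: partition_tuples_def)
  with False show ?thesis by (simp add: partition_sum_def)
qed

text \<open>Every part is at least 1, so \<open>k\<close> parts sum to at least
  \<open>k\<close>.\<close>

lemma theta_sum_eq_0: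
  assumes "n < k"
  shows "theta_sum a n k = 0"
proof -
  have False if "\<kappa> \<in> partition_tuples n n k" for \<kappa>
  proof -
    have "(\<Sum>j=1..n. \<kappa> j) \<le> (\<Sum>j=1..n. j * \<kappa> j)"
      by (intro sum_mono) simp
    then show False
      using that assms unfolding partition_tuples_def by simp
  qed
  then have "partition_tuples n n k = {}" by blast
  then show ?thesis by (simp add: partition_sum_def)
qed

text \<open>This is the coefficient of \<open>z ^ n\<close> in the \<open>m\<close>-th power of
  \<open>x + A\<close>, where \<open>A\<close> is the generating function of the \<open>a j\<close>
  with \<open>j \<ge> 1\<close>. Cutting the sum at \<open>n\<close> loses nothing, since a power of
  \<open>A\<close> beyond the \<open>n\<close>-th has no such term.\<close>

definition cfpp_coeff :: "real \<Rightarrow> (nat \<Rightarrow> real) \<Rightarrow> nat \<Rightarrow> nat \<Rightarrow> real" where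
  "cfpp_coeff x a n m = (\<Sum>k\<le>n. theta_sum a n k * (real (m choose k) * x ^ (m - k)))"

lemma geo_bounded_cfpp_coeff: "geo_bounded (cfpp_coeff x a n)"
  unfolding cfpp_coeff_def by (intro geo_bounded_sum geo_bounded_cmult geo_bounded_binomial)

lemma cfpp_coeff_0: "cfpp_coeff x a n 0 = (if n = 0 then 1 else 0)"
proof -
  have "cfpp_coeff x a n 0 = (\<Sum>k\<in>{0}. theta_sum a n k * (real (0 choose k) * x ^ (0 - k)))"
    unfolding cfpp_coeff_def by (rule sum.mono_neutral_right) auto
  then show ?thesis by (simp add: theta_sum_0)
qed

text \<open>Pascal's rule with a truncated exponent: whenever \<open>m - Suc k\<close> truncates,
  its binomial coefficient is 0.\<close>

lemma binomial_power_Suc: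
  "real (Suc m choose Suc k) * x ^ (Suc m - Suc k)
    = x * (real (m choose Suc k) * x ^ (m - Suc k)) + real (m choose k) * x ^ (m - k)"
proof (cases "Suc k \<le> m")
  case True
  then have "m - k = Suc (m - Suc k)" by simp
  then show ?thesis by (simp add: algebra_simps)
next
  case False
  then show ?thesis by simp
qed

text \<open>In terms of generating functions, one more factor \<open>x + A\<close>: Pascal's rule
  separates the contribution of \<open>x\<close> from that of \<open>A\<close>, and
  \<open>theta_sum_Suc\<close> resolves the latter.\<close>

lemma cfpp_coeff_Suc:
  "cfpp_coeff x a n (Suc m) = x * cfpp_coeff x a n m + (\<Sum>j=1..n. a j * cfpp_coeff x a (n - j) m)"
proof -
  let ?b = "\<lambda>m k. real (m choose k) * x ^ (m - k)"
  have split: "cfpp_coeff x a n m = theta_sum a n 0 * x ^ m + (\<Sum>k<n. theta_sum a n (Suc k) * ?b m (Suc k))" for m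
    unfolding cfpp_coeff_def by (subst sum.atMost_shift) simp
  \<comment> \<open>Padding with vanishing terms gives all \<open>j\<close> the same range of
    \<open>k\<close>, so that the two sums can be swapped.\<close>
  have ext: "cfpp_coeff x a (n - j) m = (\<Sum>k<n. theta_sum a (n - j) k * ?b m k)" if "j \<in> {1..n}" for j
    unfolding cfpp_coeff_def
    by (rule sum.mono_neutral_left) (use that in \<open>auto simp: theta_sum_eq_0\<close>)
  have "(\<Sum>k<n. theta_sum a n (Suc k) * ?b m k) = (\<Sum>k<n. \<Sum>j=1..n. a j * (theta_sum a (n - j) k * ?b m k))"
    unfolding theta_sum_Suc sum_distrib_right by (simp only: mult.assoc)
  also have "\<dots> = (\<Sum>j=1..n. \<Sum>k<n. a j * (theta_sum a (n - j) k * ?b m k))"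
    by (rule sum.swap)
  also have "\<dots> = (\<Sum>j=1..n. a j * cfpp_coeff x a (n - j) m)"
    by (intro sum.cong refl) (simp add: ext sum_distrib_left)
  finally have *: "(\<Sum>k<n. theta_sum a n (Suc k) * ?b m k) = (\<Sum>j=1..n. a j * cfpp_coeff x a (n - j) m)" .
  have "(\<Sum>k<n. theta_sum a n (Suc k) * ?b (Suc m) (Suc k))
      = x * (\<Sum>k<n. theta_sum a n (Suc k) * ?b m (Suc k)) + (\<Sum>k<n. theta_sum a n (Suc k) * ?b m k)"
    unfolding binomial_power_Suc by (simp add: distrib_left sum.distrib sum_distrib_left mult_ac)
  then show ?thesis
    unfolding split[of "Suc m"] split[of m] * by (simp add: algebra_simps)
qed

section \<open>The state probabilities\<close>

text \<open>Both factors vanish at negative arguments, which confines the sum over all integers to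
  \<open>0, ..., n\<close>.\<close>

lemma discrete_convolution_finite:
  assumes "\<And>j. j < 0 \<Longrightarrow> lam j = 0" "\<And>m. m < 0 \<Longrightarrow> b m = 0"
  shows "discrete_convolution lam b (int n) = (\<Sum>j\<le>n. lam (int j) * b (int (n - j)))"
proof -
  have "discrete_convolution lam b (int n) = (\<Sum>\<^sub>\<infinity>j\<in>int ` {..n}. lam j * b (int n - j))"
    unfolding discrete_convolution_def
  proof (rule infsum_cong_neutral)
    fix j :: int assume "j \<in> UNIV - int ` {..n}"
    then have "j < 0 \<or> int n - j < 0"
      using image_eqI[of j int "nat j" "{..n}"] by fastforce
    then show "lam j * b (int n - j) = 0"
      using assms by auto
  qed auto
  also have "\<dots> = (\<Sum>j\<in>int ` {..n}. lam j * b (int n - j))"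
    by simp
  also have "\<dots> = (\<Sum>j\<le>n. lam (int j) * b (int (n - j)))"
    by (subst sum.reindex) (auto simp: of_nat_diff intro!: sum.cong)
  finally show ?thesis .
qed

text \<open>Collecting the terms with the same \<open>b (int (n - j))\<close>: the convolution at
  \<open>n - 1\<close> contributes with the intensity index lowered by 1.\<close>

lemma discrete_convolution_difference:
  assumes "\<And>j. j < 0 \<Longrightarrow> lam j = 0" "\<And>m. m < 0 \<Longrightarrow> b m = 0"
  shows "- discrete_convolution lam b (int n) + discrete_convolution lam b (int n - 1)
    = - lam 0 * b (int n) + (\<Sum>j=1..n. (lam (int j - 1) - lam (int j)) * b (int (n - j)))"
proof (cases n)
  case 0
  have "discrete_convolution lam b (- 1) = 0"
    unfolding discrete_convolution_def
  proof (rule infsum_0)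
    fix j :: int
    have "j < 0 \<or> - 1 - j < 0" by linarith
    then show "lam j * b (- 1 - j) = 0" using assms by auto
  qed
  then show ?thesis
    using discrete_convolution_finite[of lam b 0, OF assms] 0 by simp
next
  case (Suc m)
  have "discrete_convolution lam b (int n)
      = lam 0 * b (int n) + (\<Sum>j\<le>m. lam (int (Suc j)) * b (int (m - j)))"
    using discrete_convolution_finite[of lam b "Suc m", OF assms] Suc by (simp add: sum.atMost_Suc_shift del: sum.atMost_Suc)
  moreover have "discrete_convolution lam b (int n - 1) = (\<Sum>j\<le>m. lam (int j) * b (int (m - j)))"
    using discrete_convolution_finite[of lam b m, OF assms] Suc by simp
  moreover have "(\<Sum>j=1..n. (lam (int j - 1) - lam (int j)) * b (int (n - j)))
      = (\<Sum>j\<le>m. (lam (int j) - lam (int (Suc j))) * b (int (m - j)))"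
    unfolding Suc One_nat_def sum.atLeast1_atMost_eq lessThan_Suc_atMost by simp
  ultimately show ?thesis
    by (simp add: left_diff_distrib sum_subtractf)
qed

text \<open>By the coefficient recursion the integrand is the series with coefficients shifted down
  by one. Integration shifts the fractional powers up, leaving only the head term missing.\<close>

lemma frac_series_cfpp_coeff_eq:
  assumes "\<alpha> > 0" "t > 0"
  shows "frac_series \<alpha> (cfpp_coeff x a n) t = (if n = 0 then 1 else 0) +
    rl_integral \<alpha> (\<lambda>s. x * frac_series \<alpha> (cfpp_coeff x a n) s
      + (\<Sum>j=1..n. a j * frac_series \<alpha> (cfpp_coeff x a (n - j)) s)) t"
proof -
  let ?D = "cfpp_coeff x a"
  have "geo_bounded (\<lambda>m. x * ?D n m + (\<Sum>j=1..n. a j * ?D (n - j) m))"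
    by (intro geo_bounded_add geo_bounded_cmult geo_bounded_sum geo_bounded_cfpp_coeff)
  then have bnd: "geo_bounded (\<lambda>m. ?D n (Suc m))"
    unfolding cfpp_coeff_Suc .
  have "frac_series \<alpha> (\<lambda>m. ?D n (Suc m)) s = x * frac_series \<alpha> (?D n) s
      + (\<Sum>j=1..n. a j * frac_series \<alpha> (?D (n - j)) s)" if "s > 0" for s
  proof -
    have sm: "(\<lambda>m. ?D i m * frac_power \<alpha> m s) sums frac_series \<alpha> (?D i) s" for i
      unfolding frac_series_def
      by (intro summable_sums geo_bounded_summable geo_bounded_cfpp_coeff assms that)
    have "(\<lambda>m. x * (?D n m * frac_power \<alpha> m s) + (\<Sum>j=1..n. a j * (?D (n - j) m * frac_power \<alpha> m s))) sums
      (x * frac_series \<alpha> (?D n) s + (\<Sum>j=1..n. a j * frac_series \<alpha> (?D (n - j)) s))"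
      by (intro sums_add sums_mult sums_sum sm)
    also have "(\<lambda>m. x * (?D n m * frac_power \<alpha> m s) + (\<Sum>j=1..n. a j * (?D (n - j) m * frac_power \<alpha> m s)))
        = (\<lambda>m. ?D n (Suc m) * frac_power \<alpha> m s)"
      unfolding cfpp_coeff_Suc distrib_right sum_distrib_right by (simp only: mult.assoc)
    finally show ?thesis
      unfolding frac_series_def[of _ "\<lambda>m. ?D n (Suc m)"] by (rule sums_unique[symmetric])
  qed
  then have "rl_integral \<alpha> (\<lambda>s. x * frac_series \<alpha> (?D n) s
      + (\<Sum>j=1..n. a j * frac_series \<alpha> (?D (n - j)) s)) t
    = rl_integral \<alpha> (frac_series \<alpha> (\<lambda>m. ?D n (Suc m))) t"
    by (intro rl_integral_cong) simp
  also have "\<dots> = (\<Sum>m. ?D n (Suc m) * frac_power \<alpha> (Suc m) t)"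
    by (rule rl_integral_frac_series[OF assms bnd])
  also have "\<dots> = frac_series \<alpha> (?D n) t - ?D n 0 * frac_power \<alpha> 0 t"
    unfolding frac_series_def
    by (rule suminf_split_head) (intro geo_bounded_summable geo_bounded_cfpp_coeff assms)
  finally show ?thesis
    using assms by (simp add: cfpp_coeff_0 frac_power_0)
qed

text \<open>Strong induction on \<open>n\<close>: the contributions of smaller indices agree and
  cancel, so the difference of the two solutions satisfies the homogeneous equation of
  \<open>rl_integral_eigen_zero\<close>.\<close>

lemma cfpp_system_unique:
  fixes p :: "nat \<Rightarrow> real \<Rightarrow> real"
  assumes "\<alpha> > 0" "\<And>n. loc_bounded (p n)"
    and "\<And>n t. t > 0 \<Longrightarrow> p n t = (if n = 0 then 1 else 0) +
      rl_integral \<alpha> (\<lambda>s. x * p n s + (\<Sum>j=1..n. a j * p (n - j) s)) t"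
    and "t > 0"
  shows "p n t = frac_series \<alpha> (cfpp_coeff x a n) t"
  using assms(4)
proof (induction n arbitrary: t rule: less_induct)
  case (less n)
  define q where "q = (\<lambda>n. frac_series \<alpha> (cfpp_coeff x a n))"
  have q: "loc_bounded (q n)" for n
    unfolding q_def by (intro loc_bounded_frac_series geo_bounded_cfpp_coeff assms)
  have "loc_bounded (\<lambda>s. p n s + (- 1) * q n s)"
    by (intro loc_bounded_add loc_bounded_cmult assms q)
  then have d: "loc_bounded (\<lambda>s. p n s - q n s)" by simp
  have "p n u - q n u = rl_integral \<alpha> (\<lambda>s. x * (p n s - q n s)) u" if "u > 0" for u
  proof -
    have "p n u - q n u = rl_integral \<alpha> (\<lambda>s. x * p n s + (\<Sum>j=1..n. a j * p (n - j) s)) u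
        - rl_integral \<alpha> (\<lambda>s. x * q n s + (\<Sum>j=1..n. a j * q (n - j) s)) u"
      using assms(3)[OF that, of n] frac_series_cfpp_coeff_eq[OF assms(1) that, of x a n]
      by (simp add: q_def)
    also have "\<dots> = rl_integral \<alpha> (\<lambda>s. (x * p n s + (\<Sum>j=1..n. a j * p (n - j) s))
        - (x * q n s + (\<Sum>j=1..n. a j * q (n - j) s))) u"
      by (intro rl_integral_diff loc_bounded_add loc_bounded_cmult loc_bounded_sum assms that q)
    also have "\<dots> = rl_integral \<alpha> (\<lambda>s. x * (p n s - q n s)) u"
    proof (rule rl_integral_cong)
      fix s :: real assume "0 < s"
      then have "(\<Sum>j=1..n. a j * p (n - j) s) = (\<Sum>j=1..n. a j * q (n - j) s)"
        unfolding q_def by (intro sum.cong refl arg_cong2[where f = "(*)"] less.IH) auto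
      then show "(x * p n s + (\<Sum>j=1..n. a j * p (n - j) s)) - (x * q n s + (\<Sum>j=1..n. a j * q (n - j) s))
          = x * (p n s - q n s)"
        by (simp add: right_diff_distrib)
    qed
    finally show ?thesis .
  qed
  from rl_integral_eigen_zero[OF assms(1) d this less.prems] show ?case
    by (simp add: q_def)
qed

text \<open>The terms with \<open>m < k\<close> vanish. After a shift by \<open>k\<close>, the
  binomial coefficient supplies the quotient of Gamma values in the Mittag-Leffler series.\<close>

lemma frac_series_binomial:
  assumes "\<alpha> > 0" "t > 0"
  shows "frac_series \<alpha> (\<lambda>m. real (m choose k) * x ^ (m - k)) t
    = t powr (real k * \<alpha>) * mittag_leffler3 \<alpha> (real k * \<alpha> + 1) (real k + 1) (x * t powr \<alpha>)"
proof -
  let ?b = "\<lambda>m. real (m choose k) * x ^ (m - k) * frac_power \<alpha> m t"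
  let ?g = "\<lambda>m. Gamma (real k + 1 + real m) * (x * t powr \<alpha>) ^ m / (fact m * Gamma (real m * \<alpha> + (real k * \<alpha> + 1)))"
  let ?c = "t powr (real k * \<alpha>) / Gamma (real k + 1)"
  have "?b sums frac_series \<alpha> (\<lambda>m. real (m choose k) * x ^ (m - k)) t"
    unfolding frac_series_def
    by (intro summable_sums geo_bounded_summable geo_bounded_binomial assms)
  moreover have "(\<Sum>m<k. ?b m) = 0"
    by (rule sum.neutral) simp
  ultimately have "(\<lambda>m. ?b (m + k)) sums frac_series \<alpha> (\<lambda>m. real (m choose k) * x ^ (m - k)) t"
    using sums_split_initial_segment[of ?b _ k] by simp
  moreover have "?b (m + k) = ?c * ?g m" for m
  proof -
    have G: "Gamma (real k + 1 + real m) = fact (m + k)" "Gamma (real k + 1) = fact k"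
      using Gamma_fact[of "m + k", where 'a = real] Gamma_fact[of k, where 'a = real] by (simp_all add: add_ac)
    have "real (m + k choose k) = fact (m + k) / (fact k * fact m)"
      by (subst binomial_fact) simp_all
    moreover have "t powr (real (m + k) * \<alpha>) = t powr (real k * \<alpha>) * (t powr \<alpha>) ^ m"
    proof -
      have "(t powr \<alpha>) ^ m = t powr (real m * \<alpha>)"
        using assms by (simp add: powr_powr mult.commute flip: powr_realpow)
      then show ?thesis
        by (simp add: distrib_right powr_add)
    qed
    moreover have "real (m + k) * \<alpha> + 1 = real m * \<alpha> + (real k * \<alpha> + 1)"
      by (simp add: algebra_simps)
    ultimately show ?thesis
      unfolding frac_power_def G power_mult_distrib by (simp add: mult_ac add_ac)
  qed
  moreover have c: "?c \<noteq> 0"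
  proof -
    have "Gamma (real k + 1) \<noteq> 0"
      using Gamma_fact[of k, where 'a = real] by (simp add: add.commute)
    with assms show ?thesis by simp
  qed
  \<comment> \<open>With the limit written as a multiple of \<open>?c\<close>, cancelling that
    factor yields the convergence of \<open>?g\<close> together with its sum.\<close>
  ultimately have "(\<lambda>m. ?c * ?g m) sums (?c * (frac_series \<alpha> (\<lambda>m. real (m choose k) * x ^ (m - k)) t / ?c))"
    by simp
  then have "?g sums (frac_series \<alpha> (\<lambda>m. real (m choose k) * x ^ (m - k)) t / ?c)"
    unfolding sums_mult_iff[OF c] .
  then have "mittag_leffler3 \<alpha> (real k * \<alpha> + 1) (real k + 1) (x * t powr \<alpha>)
      = 1 / Gamma (real k + 1) * (frac_series \<alpha> (\<lambda>m. real (m choose k) * x ^ (m - k)) t / ?c)"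
    unfolding mittag_leffler3_def by (simp only: sums_unique[symmetric])
  then show ?thesis
    using c by simp
qed

lemma frac_series_cfpp_coeff:
  assumes "\<alpha> > 0" "t > 0"
  shows "frac_series \<alpha> (cfpp_coeff x a n) t = (\<Sum>k\<le>n. theta_sum a n k *
    (t powr (real k * \<alpha>) * mittag_leffler3 \<alpha> (real k * \<alpha> + 1) (real k + 1) (x * t powr \<alpha>)))"
proof -
  have "(\<lambda>m. real (m choose k) * x ^ (m - k) * frac_power \<alpha> m t) sums
      frac_series \<alpha> (\<lambda>m. real (m choose k) * x ^ (m - k)) t" for k
    unfolding frac_series_def
    by (intro summable_sums geo_bounded_summable geo_bounded_binomial assms)
  then have "(\<lambda>m. \<Sum>k\<le>n. theta_sum a n k * (real (m choose k) * x ^ (m - k) * frac_power \<alpha> m t)) sums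
      (\<Sum>k\<le>n. theta_sum a n k * frac_series \<alpha> (\<lambda>m. real (m choose k) * x ^ (m - k)) t)"
    by (intro sums_sum sums_mult)
  moreover have "(\<Sum>k\<le>n. theta_sum a n k * (real (m choose k) * x ^ (m - k) * frac_power \<alpha> m t))
      = cfpp_coeff x a n m * frac_power \<alpha> m t" for m
    unfolding cfpp_coeff_def sum_distrib_right by (simp only: mult.assoc)
  ultimately have "(\<lambda>m. cfpp_coeff x a n m * frac_power \<alpha> m t) sums
      (\<Sum>k\<le>n. theta_sum a n k * frac_series \<alpha> (\<lambda>m. real (m choose k) * x ^ (m - k)) t)"
    by (simp only:)
  then show ?thesis
    unfolding frac_series_binomial[OF assms] frac_series_def[of _ "cfpp_coeff x a n"] by (rule sums_unique[symmetric])
qed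

text \<open>Probabilities are bounded by 1, and continuity supplies measurability.\<close>

lemma loc_bounded_state_prob:
  assumes "prob_space M" "continuous_on {0..} (state_prob M N n)"
  shows "loc_bounded (state_prob M N n)"
  unfolding loc_bounded_def
proof (intro conjI allI)
  interpret prob_space M by fact
  have "continuous_on {0<..} (state_prob M N n)"
    by (rule continuous_on_subset[OF assms(2)]) auto
  then show "set_borel_measurable lborel {0<..} (state_prob M N n)"
    using borel_measurable_continuous_on_indicator[of "{0<..}" "state_prob M N n"]
    by (simp add: set_borel_measurable_def)
  show "\<exists>B. \<forall>s\<in>{0<..T}. \<bar>state_prob M N n s\<bar> \<le> B" for T
    by (intro exI[of _ 1]) (simp add: state_prob_def)
qed

theorem theorem3p1:
  fixes \<alpha> t :: real and lam :: "int \<Rightarrow> real" and n :: nat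
    and M :: "'a measure" and N :: "real \<Rightarrow> 'a \<Rightarrow> nat"
  assumes "0 < \<alpha>" and "\<alpha> \<le> 1"
    and "intensity_parameters lam"
    and "conv_frac_poisson_process M \<alpha> lam N"
    and "t \<ge> 0"
  shows "state_prob M N (int n) t =
    (if n = 0 then mittag_leffler \<alpha> 1 (- lam 0 * t powr \<alpha>)
     else (\<Sum>k=1..n. \<Sum>\<kappa>\<in>Theta n k.
       fact k * (\<Prod>j=1..n. (lam (int j - 1) - lam (int j)) ^ \<kappa> j / fact (\<kappa> j)) *
       t powr (real k * \<alpha>) *
       mittag_leffler3 \<alpha> (real k * \<alpha> + 1) (real k + 1) (- lam 0 * t powr \<alpha>)))"
proof -
  define a where "a j = lam (int j - 1) - lam (int j)" for j
  define p where "p = state_prob M N"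
  have prob: "prob_space M" and eqs: "cfpp_equations \<alpha> lam p"
    using assms(4) by (auto simp: conv_frac_poisson_process_def p_def)
  have lam: "lam j = 0" if "j < 0" for j
    using assms(3) that by (simp add: intensity_parameters_def)
  have neg: "p m s = 0" if "m < 0" for m s
    using that by (simp add: p_def state_prob_def)
  have init: "p (int i) 0 = (if i = 0 then 1 else 0)" for i
    using eqs by (simp add: cfpp_equations_def)
  have diff: "caputo_differentiable \<alpha> (p (int i))" for i
    using eqs by (simp add: cfpp_equations_def)
  have bnd: "loc_bounded (p (int i))" for i
    using loc_bounded_state_prob[OF prob] diff[of i] by (simp add: p_def caputo_differentiable_def)
  show ?thesis
  \<comment> \<open>Time 0 is settled by the initial values: since \<open>0 powr 0\<close> is 0, the
    fractional series has the default value 0 there.\<close>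
  proof (cases "t = 0")
    case True
    \<comment> \<open>Here \<open>0 ^ 0\<close> is 1, so exactly the term \<open>k = 0\<close>
      survives.\<close>
    have "(\<Sum>k. 0 ^ k / Gamma (real k * \<alpha> + 1)) = 1"
      using powser_zero[of "\<lambda>k. 1 / Gamma (real k * \<alpha> + 1)"] by simp
    with True show ?thesis
      using init[of n] by (simp add: p_def mittag_leffler_series)
  next
    case False
    then have t: "t > 0" using assms(5) by simp
    have "p (int n) t = frac_series \<alpha> (cfpp_coeff (- lam 0) a n) t"
    proof (rule cfpp_system_unique[OF assms(1) bnd _ t])
      fix i and u :: real assume u: "u > 0"
      show "p (int i) u = (if i = 0 then 1 else 0) +
        rl_integral \<alpha> (\<lambda>s. - lam 0 * p (int i) s + (\<Sum>j=1..i. a j * p (int (i - j)) s)) u"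
        \<comment> \<open>The constant term is read as the initial value, matching the integrated
          form of the differential equation.\<close>
        unfolding init[of i, symmetric]
      proof (rule rl_integral_caputo_deriv[OF assms(1,2) u diff])
        show "loc_bounded (\<lambda>s. - lam 0 * p (int i) s + (\<Sum>j=1..i. a j * p (int (i - j)) s))"
          by (intro loc_bounded_add loc_bounded_cmult loc_bounded_sum bnd)
        show "caputo_deriv \<alpha> (p (int i)) s = - lam 0 * p (int i) s + (\<Sum>j=1..i. a j * p (int (i - j)) s)"
          if "s > 0" for s
          using eqs that discrete_convolution_difference[of lam "\<lambda>m. p m s" i, OF lam neg]
          by (simp add: cfpp_equations_def a_def)
      qed
    qed
    also have "\<dots> = (\<Sum>k\<le>n. theta_sum a n k * (t powr (real k * \<alpha>) *
        mittag_leffler3 \<alpha> (real k * \<alpha> + 1) (real k + 1) (- lam 0 * t powr \<alpha>)))"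
      by (rule frac_series_cfpp_coeff[OF assms(1) t])
    finally have main: "state_prob M N (int n) t = (\<Sum>k\<le>n. theta_sum a n k * (t powr (real k * \<alpha>) *
        mittag_leffler3 \<alpha> (real k * \<alpha> + 1) (real k + 1) (- lam 0 * t powr \<alpha>)))"
      by (simp add: p_def)
    show ?thesis
    proof (cases "n = 0")
      case True
      then show ?thesis
        using main t by (simp add: theta_sum_0 mittag_leffler_def)
    next
      case False
      \<comment> \<open>The term \<open>k = 0\<close> drops out because a positive \<open>n\<close>
        is not a sum of no parts.\<close>
      have "{..n} = insert 0 {1..n}" by auto
      then have "state_prob M N (int n) t = (\<Sum>k=1..n. theta_sum a n k * (t powr (real k * \<alpha>) *
          mittag_leffler3 \<alpha> (real k * \<alpha> + 1) (real k + 1) (- lam 0 * t powr \<alpha>)))"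
        unfolding main using False by (simp add: theta_sum_0)
      with False show ?thesis
        by (simp only: if_False partition_sum_def partition_weight_def partition_tuples_Theta a_def
            sum_distrib_right mult.assoc)
    qed
  qed
qed

end
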